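(* Let $\beta\ge5$, $\epsilon_1\in\{0,1\}$ and $\epsilon_2\in\{1,-1\}$. There is no tight chiral $4$-polytope of type $\{2^{\beta-2},2^{\beta-1},2^\beta\}$ whose standard generators satisfy $\sigma_2\sigma_1^{-1}=\sigma_1\sigma_2^{3-\epsilon_12^{\beta-2}}$, $\sigma_3^{-1}\sigma_2=\sigma_2^{-1+2^{\beta-2}}\sigma_3^{-3+\epsilon_22^{\beta-2}}$ and $\sigma_3\sigma_2^{-1}=\sigma_2^{1+2^{\beta-2}}\sigma_3^{3+\epsilon_22^{\beta-2}}$.
   Context: For a chiral polytope with base flag $\Phi$, the standard generators $\sigma_1,\sigma_2,\sigma_3$ of its automorphism group are the automorphisms with $\Phi\sigma_i=\Phi^{i(i-1)}$, where $\Phi^j$ is the flag differing from $\Phi$ only in its $j$-face; for type $\{p,q,r\}$ they have orders $p,q,r$ and satisfy $(\sigma_1\sigma_2)^2=(\sigma_2\sigma_3)^2=(\sigma_1\sigma_2\sigma_3)^2=1$. Tight: type $\{p,q,r\}$ with exactly $2pqr$ flags. *)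

theory Defs
  imports "HOL-Algebra.Bij" "HOL-Algebra.Group"
begin

text \<open>An abstract polytope is given by a set of faces P, a partial order leq on P,
and its rank function rk (which is uniquely determined by the poset when it exists).\<close>

definition pchain :: "'a set \<Rightarrow> ('a \<Rightarrow> 'a \<Rightarrow> bool) \<Rightarrow> 'a set \<Rightarrow> bool" where
  "pchain P leq C \<longleftrightarrow> C \<subseteq> P \<and> (\<forall>x\<in>C. \<forall>y\<in>C. leq x y \<or> leq y x)"

definition flags :: "'a set \<Rightarrow> ('a \<Rightarrow> 'a \<Rightarrow> bool) \<Rightarrow> 'a set set" where
  "flags P leq = {C. pchain P leq C \<and> (\<forall>D. pchain P leq D \<and> C \<subseteq> D \<longrightarrow> D = C)}"

definition adjacent_flags :: "'a set \<Rightarrow> 'a set \<Rightarrow> bool" where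
  "adjacent_flags \<Phi> \<Psi> \<longleftrightarrow> card (\<Phi> - \<Psi>) = 1"

definition flag_adj :: "'a set \<Rightarrow> ('a \<Rightarrow> 'a \<Rightarrow> bool) \<Rightarrow> ('a \<Rightarrow> int) \<Rightarrow> int \<Rightarrow> 'a set \<Rightarrow> 'a set" where
  "flag_adj P leq rk j \<Phi> =
     (THE \<Psi>. \<Psi> \<in> flags P leq \<and> \<Psi> \<noteq> \<Phi> \<and> (\<forall>x\<in>\<Phi>. rk x \<noteq> j \<longrightarrow> x \<in> \<Psi>))"

definition strongly_flag_connected :: "'a set \<Rightarrow> ('a \<Rightarrow> 'a \<Rightarrow> bool) \<Rightarrow> bool" where
  "strongly_flag_connected P leq \<longleftrightarrow>
    (\<forall>\<Phi>\<in>flags P leq. \<forall>\<Psi>\<in>flags P leq. \<exists>xs. xs \<noteq> [] \<and> hd xs = \<Phi> \<and> last xs = \<Psi> \<and>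
        set xs \<subseteq> flags P leq \<and>
        (\<forall>i. Suc i < length xs \<longrightarrow> adjacent_flags (xs ! i) (xs ! Suc i)) \<and>
        (\<forall>\<Omega>\<in>set xs. \<Phi> \<inter> \<Psi> \<subseteq> \<Omega>))"

definition abstract_polytope :: "nat \<Rightarrow> 'a set \<Rightarrow> ('a \<Rightarrow> 'a \<Rightarrow> bool) \<Rightarrow> ('a \<Rightarrow> int) \<Rightarrow> bool" where
  "abstract_polytope n P leq rk \<longleftrightarrow>
     (\<forall>x\<in>P. leq x x) \<and>
     (\<forall>x\<in>P. \<forall>y\<in>P. leq x y \<and> leq y x \<longrightarrow> x = y) \<and>
     (\<forall>x\<in>P. \<forall>y\<in>P. \<forall>z\<in>P. leq x y \<and> leq y z \<longrightarrow> leq x z) \<and>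
     (\<exists>m\<in>P. \<forall>x\<in>P. leq m x) \<and> (\<exists>M\<in>P. \<forall>x\<in>P. leq x M) \<and>
     (\<forall>x\<in>P. \<forall>y\<in>P. leq x y \<and> x \<noteq> y \<longrightarrow> rk x < rk y) \<and>
     (\<forall>\<Phi>\<in>flags P leq. bij_betw rk \<Phi> {-1..int n}) \<and>
     (\<forall>F\<in>P. \<forall>G\<in>P. leq F G \<and> rk G = rk F + 2 \<longrightarrow>
         card {H\<in>P. leq F H \<and> leq H G \<and> H \<noteq> F \<and> H \<noteq> G} = 2) \<and>
     strongly_flag_connected P leq"

text \<open>The automorphism group (as a subgroup of the bijections of P, HOL-Algebra).
 Note: HOL-Algebra multiplication is composition, g \<otimes> f = g \<circ> f.\<close>
definition polytope_aut :: "'a set \<Rightarrow> ('a \<Rightarrow> 'a \<Rightarrow> bool) \<Rightarrow> ('a \<Rightarrow> 'a) monoid" where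
  "polytope_aut P leq = (BijGroup P)\<lparr>carrier :=
     {\<sigma> \<in> Bij P. \<forall>x\<in>P. \<forall>y\<in>P. leq x y \<longleftrightarrow> leq (\<sigma> x) (\<sigma> y)}\<rparr>"

text \<open>Products written as in the paper, where automorphisms act on the right
 (Phi (s t) = (Phi s) t): the product "s t" of the paper is t \<otimes> s.\<close>
definition rprod :: "('b, 'c) monoid_scheme \<Rightarrow> 'b \<Rightarrow> 'b \<Rightarrow> 'b" where
  "rprod G s t = t \<otimes>\<^bsub>G\<^esub> s"

definition chiral_polytope :: "nat \<Rightarrow> 'a set \<Rightarrow> ('a \<Rightarrow> 'a \<Rightarrow> bool) \<Rightarrow> ('a \<Rightarrow> int) \<Rightarrow> bool" where
  "chiral_polytope n P leq rk \<longleftrightarrow>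
     abstract_polytope n P leq rk \<and>
     card {{\<sigma> ` \<Phi> | \<sigma>. \<sigma> \<in> carrier (polytope_aut P leq)} | \<Phi>. \<Phi> \<in> flags P leq} = 2 \<and>
     (\<forall>\<Phi>\<in>flags P leq. \<forall>\<Psi>\<in>flags P leq. adjacent_flags \<Phi> \<Psi> \<longrightarrow>
        \<not> (\<exists>\<sigma>\<in>carrier (polytope_aut P leq). \<sigma> ` \<Phi> = \<Psi>))"

definition has_type :: "nat \<Rightarrow> 'a set \<Rightarrow> ('a \<Rightarrow> 'a \<Rightarrow> bool) \<Rightarrow> ('a \<Rightarrow> int) \<Rightarrow> nat list \<Rightarrow> bool" where
  "has_type n P leq rk ps \<longleftrightarrow> length ps = n - 1 \<and>
     (\<forall>j\<in>{1..n-1}. \<forall>F\<in>P. \<forall>G\<in>P. leq F G \<and> rk F = int j - 2 \<and> rk G = int j + 1 \<longrightarrow>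
        card {H\<in>P. leq F H \<and> leq H G \<and> rk H = int j - 1} = ps ! (j - 1))"

definition standard_generator ::
  "'a set \<Rightarrow> ('a \<Rightarrow> 'a \<Rightarrow> bool) \<Rightarrow> ('a \<Rightarrow> int) \<Rightarrow> 'a set \<Rightarrow> int \<Rightarrow> ('a \<Rightarrow> 'a) \<Rightarrow> bool" where
  "standard_generator P leq rk \<Phi> i \<sigma> \<longleftrightarrow>
     \<sigma> \<in> carrier (polytope_aut P leq) \<and>
     \<sigma> ` \<Phi> = flag_adj P leq rk (i - 1) (flag_adj P leq rk i \<Phi>)"

end

theory Submission
  imports Defs "HOL-Algebra.Multiplicative_Group"
begin

text \<open>
Put \<open>N = 2\<^bsup>\<beta>-2\<^esup>\<close> and write \<open>a, b, c\<close> for the standard generators. The relations between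
\<open>b\<close> and \<open>c\<close> make a generator of \<open>\<langle>c\<^sup>4\<rangle>\<close> a power of \<open>c b\<^sup>2\<close>, so \<open>c\<^sup>4\<close> commutes with
\<open>b\<^sup>2\<close>; squaring the relations then gives
\<open>c\<^sup>-\<^sup>1 b\<^sup>4 c = c b\<^sup>4 c\<^sup>-\<^sup>1 = c\<^bsup>2N-8\<^esup> b\<^sup>-\<^sup>4\<close>. The relation between \<open>a\<close> and \<open>b\<close> makes \<open>b\<^sup>4\<close>
commute with \<open>a\<close>, so the involution \<open>ab\<close> centralizes \<open>b\<^sup>4\<close>, while it inverts \<open>c\<close> because \<open>abc\<close> is an
involution as well. Conjugating by it yields \<open>c\<^bsup>2N-8\<^esup> = c\<^bsup>8-2N\<^esup>\<close>, so the order \<open>4N\<close> of \<open>c\<close> divides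
\<open>4N - 16\<close>, which is impossible for \<open>N \<ge> 8\<close>.

The order of a standard generator equals the corresponding entry of the type because its powers
act transitively on the relevant faces of a rank 2 section, and a power fixing such a face maps the
base flag to itself or to an adjacent flag; chirality excludes the latter.
\<close>

section \<open>Consequences of the relations in an abstract group\<close>

context group
begin

lemma inv_mult_cancel [simp]:
  assumes "x \<in> carrier G" "y \<in> carrier G"
  shows "inv x \<otimes> (x \<otimes> y) = y" "x \<otimes> (inv x \<otimes> y) = y"
  using assms by (simp_all flip: m_assoc)

lemma int_pow_mult_left:
  fixes i j :: int
  assumes "x \<in> carrier G" "y \<in> carrier G"
  shows "x [^] i \<otimes> (x [^] j \<otimes> y) = x [^] (i + j) \<otimes> y"
  using assms by (simp add: m_assoc int_pow_mult)

lemma int_pow_conj: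
  fixes i :: int
  assumes "x \<in> carrier G" "y \<in> carrier G"
  shows "(inv y \<otimes> x \<otimes> y) [^] i = inv y \<otimes> x [^] i \<otimes> y"
proof -
  have "(\<lambda>u. inv y \<otimes> u \<otimes> y) \<in> hom G G"
    using assms by (auto intro!: homI simp: m_assoc)
  from hom_int_pow[OF this assms(1) is_group is_group] show ?thesis
    by simp
qed

lemma int_pow_commute:
  fixes i :: int
  assumes "x \<in> carrier G" "y \<in> carrier G" "x \<otimes> y = y \<otimes> x"
  shows "x [^] i \<otimes> y = y \<otimes> x [^] i"
proof -
  have "inv y \<otimes> x \<otimes> y = x" using assms by (simp add: m_assoc)
  then have "x [^] i = inv y \<otimes> x [^] i \<otimes> y" using int_pow_conj[OF assms(1,2), of i] by simp
  then have "y \<otimes> x [^] i = y \<otimes> (inv y \<otimes> x [^] i \<otimes> y)" by simp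
  then show ?thesis using assms by (simp add: m_assoc)
qed

lemma int_pow_conj_eq:
  fixes i :: int
  assumes "x \<in> carrier G" "y \<in> carrier G" "z \<in> carrier G" "inv y \<otimes> x \<otimes> y = z"
  shows "inv y \<otimes> x [^] i \<otimes> y = z [^] i"
  using int_pow_conj[OF assms(1,2)] assms(4) by simp

lemma inv_equality_right:
  assumes "x \<otimes> y = \<one>" "x \<in> carrier G" "y \<in> carrier G"
  shows "inv x = y"
  using inv_comm[OF assms] assms(2,3) by (rule inv_equality)


text \<open>The products are in composition order, the reverse of the order used in the paper.\<close>
lemma pow_eq_one_of_relations:
  fixes N g e d :: int
  assumes carr: "a \<in> carrier G" "b \<in> carrier G" "c \<in> carrier G"
    and N: "N = 8 * g" and e: "e * e = 1"
    and bN: "b [^] (2 * N) = \<one>" and cN: "c [^] (4 * N) = \<one>"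
    and ba: "b \<otimes> a \<otimes> (b \<otimes> a) = \<one>"
    and cb: "c \<otimes> b \<otimes> (c \<otimes> b) = \<one>"
    and cba: "c \<otimes> (b \<otimes> a) \<otimes> (c \<otimes> (b \<otimes> a)) = \<one>"
    and r1: "inv a \<otimes> b = b [^] (3 - d * N) \<otimes> a"
    and r2: "b \<otimes> inv c = c [^] (-3 + e * N) \<otimes> b [^] (-1 + N)"
    and r3: "inv b \<otimes> c = c [^] (3 + e * N) \<otimes> b [^] (1 + N)"
  shows "c [^] (4 * N - 16) = \<one>"
proof -
  note [simp] = carr
  have e_cases: "e = 1 \<or> e = -1" using e zmult_eq_1_iff by blast
  \<comment> \<open>Exponents of \<open>b\<close> count modulo \<open>2N\<close> and exponents of
    \<open>c\<close> modulo \<open>4N\<close>; the third variable \<open>k\<close> is the explicit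
    quotient, supplied by hand at each use.\<close>
  have bmod: "b [^] i = b [^] j" if "i = j + 2 * N * k" for i j k :: int
    using that bN by (simp add: int_pow_mult flip: int_pow_pow)
  have cmod: "c [^] i = c [^] j" if "i = j + 4 * N * k" for i j k :: int
    using that cN by (simp add: int_pow_mult flip: int_pow_pow)
  have pow1i: "inv y = y [^] (-1::int)" if "y \<in> carrier G" for y using that by (simp add: int_pow_neg)

  have b4a: "inv a \<otimes> b [^] (4::int) \<otimes> a = b [^] (4::int)"
  proof -
    have "inv b = a \<otimes> (b \<otimes> a)"
      using ba by (intro inv_equality_right) (simp_all add: m_assoc)
    then have "inv a \<otimes> inv b = b \<otimes> a" by simp
    \<comment> \<open>By \<open>r1\<close> the last factor is \<open>a^-1 b\<close>, so the
      conjugate collapses to \<open>(b a)(a^-1 b) = b^2\<close>. Squaring then removes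
      \<open>d\<close>, since \<open>2dN\<close> is a multiple of \<open>2N\<close>.\<close>
    moreover have "inv a \<otimes> b [^] (2 - d * N) \<otimes> a = inv a \<otimes> inv b \<otimes> (b [^] (3 - d * N) \<otimes> a)"
    proof -
      have "b [^] (2 - d * N) = inv b \<otimes> b [^] (3 - d * N)"
        unfolding pow1i[OF carr(2)] by (simp flip: int_pow_mult)
      then show ?thesis by (simp add: m_assoc)
    qed
    ultimately have "inv a \<otimes> b [^] (2 - d * N) \<otimes> a = b \<otimes> b"
      unfolding r1[symmetric] by (simp add: m_assoc)
    then have "inv a \<otimes> b [^] (2 - d * N) \<otimes> a = b [^] (2::int)"
      using int_pow_mult[of b 1 1] by simp
    from int_pow_conj_eq[OF _ _ _ this, of 2]
    have "inv a \<otimes> b [^] ((2 - d * N) * 2) \<otimes> a = b [^] (4::int)" by (simp add: int_pow_pow)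
    moreover have "b [^] ((2 - d * N) * 2) = b [^] (4::int)" by (rule bmod[of _ _ "-d"]) (simp add: algebra_simps)
    ultimately show ?thesis by simp
  qed

  define x where "x = b [^] (2::int)"
  have [simp]: "x \<in> carrier G" by (simp add: x_def)
  \<comment> \<open>The relation \<open>(c b)^2 = 1\<close> makes \<open>z^-1\<close> the conjugate
    of \<open>c\<close> by \<open>b\<close> (\<open>conj_c\<close>), so conjugation by
    \<open>b\<close> turns powers of \<open>c\<close> into powers of \<open>z\<close>.\<close>
  define z where "z = c \<otimes> x"
  have [simp]: "z \<in> carrier G" by (simp add: z_def)
  have bb: "b \<otimes> b = x" using int_pow_mult[of b 1 1] by (simp add: x_def)
  have cinv: "inv c = b \<otimes> (c \<otimes> b)"
    using cb by (intro inv_equality_right) (simp_all add: m_assoc)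
  have s2: "x \<otimes> c = c [^] (-3 + e * N) \<otimes> b [^] (-2 + N)"
  proof -
    have "x \<otimes> c = b \<otimes> inv c \<otimes> inv b"
      unfolding cinv bb[symmetric] by (simp add: m_assoc)
    also have "\<dots> = c [^] (-3 + e * N) \<otimes> (b [^] (-1 + N) \<otimes> inv b)"
      unfolding r2 by (simp add: m_assoc)
    finally show ?thesis unfolding pow1i[OF carr(2)] by (simp flip: int_pow_mult)
  qed
  have c': "c = inv b \<otimes> inv c \<otimes> inv b"
    unfolding cinv by (simp add: m_assoc)
  have conj_c: "inv b \<otimes> c \<otimes> b = inv z"
    by (subst c') (simp add: z_def inv_mult_group m_assoc flip: bb)
  have s3: "inv z = c [^] (3 + e * N) \<otimes> b [^] (2 + N)"
  proof -
    have "inv z = inv b \<otimes> c \<otimes> b" by (simp add: conj_c)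
    also have "\<dots> = c [^] (3 + e * N) \<otimes> (b [^] (1 + N) \<otimes> b)"
      unfolding r3 by (simp add: m_assoc)
    also have "b [^] (1 + N) \<otimes> b = b [^] (2 + N)"
      using int_pow_mult[of b "1 + N" 1] by (simp add: add.commute)
    finally show ?thesis .
  qed
  \<comment> \<open>This is \<open>s2\<close> conjugated by \<open>b\<close>: the left side becomes
    \<open>x z^-1 = c^-1\<close>, and the powers of \<open>b\<close> are unaffected.\<close>
  have s4: "inv c = z [^] (3 - e * N) \<otimes> b [^] (-2 + N)"
  proof -
    have "inv c = x \<otimes> inv z" by (simp add: z_def inv_mult_group)
    also have "\<dots> = inv b \<otimes> (x \<otimes> c) \<otimes> b"
      by (simp add: m_assoc flip: conj_c bb)
    also have "\<dots> = (inv b \<otimes> c [^] (-3 + e * N) \<otimes> b) \<otimes> b [^] (-2 + N)"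
      unfolding s2 using int_pow_commute[of b b "-2 + N"] by (simp add: m_assoc)
    also have "inv b \<otimes> c [^] (-3 + e * N) \<otimes> b = inv z [^] (-3 + e * N)"
      by (rule int_pow_conj_eq) (simp_all add: conj_c)
    also have "\<dots> = z [^] (3 - e * N)"
      by (simp add: int_pow_inv flip: int_pow_neg)
    finally show ?thesis .
  qed
  \<comment> \<open>Since \<open>b^(2N) = 1\<close>, the powers of \<open>b\<close> in
    \<open>s3\<close> and \<open>s4\<close> can be cancelled against each other. What remains
    relates powers of \<open>z\<close> and \<open>c\<close> alone.\<close>
  have key: "z [^] (-4 + e * N) = c [^] (4 + e * N)"
  proof -
    have "inv c \<otimes> b [^] (2 + N) = z [^] (3 - e * N) \<otimes> (b [^] (-2 + N) \<otimes> b [^] (2 + N))"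
      unfolding s4 by (simp add: m_assoc)
    also have "b [^] (-2 + N) \<otimes> b [^] (2 + N) = \<one>"
      using bN by (simp flip: int_pow_mult)
    finally have 1: "inv c \<otimes> b [^] (2 + N) = z [^] (3 - e * N)" by simp
    have "inv z = c [^] (4 + e * N) \<otimes> (inv c \<otimes> b [^] (2 + N))"
      unfolding s3 pow1i[OF carr(3)] by (simp add: int_pow_mult_left)
    then have "inv z \<otimes> z [^] (-3 + e * N) = c [^] (4 + e * N) \<otimes> (z [^] (3 - e * N) \<otimes> z [^] (-3 + e * N))"
      unfolding 1 by (simp add: m_assoc)
    then show ?thesis
      unfolding pow1i[OF \<open>z \<in> carrier G\<close>] by (simp flip: int_pow_mult)
  qed
  \<comment> \<open>By \<open>key\<close> this power of \<open>c\<close> is also a power of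
    \<open>z = c x\<close>; it commutes with both \<open>c\<close> and \<open>c x\<close>, hence
    with \<open>x\<close>.\<close>
  have "c [^] (4 + e * N) \<otimes> x = x \<otimes> c [^] (4 + e * N)"
  proof -
    have "c [^] (4 + e * N) \<otimes> z = z \<otimes> c [^] (4 + e * N)"
      unfolding key[symmetric] by (rule int_pow_commute) simp_all
    then have "c \<otimes> (c [^] (4 + e * N) \<otimes> x) = c \<otimes> (x \<otimes> c [^] (4 + e * N))"
      using int_pow_commute[of c c "4 + e * N"] by (simp add: z_def flip: m_assoc)
    then show ?thesis by simp
  qed
  \<comment> \<open>\<open>(1 - 2eg)(1 + 4g\<^sup>2)\<close> inverts \<open>1 + 2eg\<close> modulo \<open>N\<close>, so \<open>c\<^bsup>4+eN\<^esup>\<close> generates \<open>\<langle>c\<^sup>4\<rangle>\<close>.\<close>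
  then have "(c [^] (4 + e * N)) [^] ((1 - 2 * e * g) * (1 + 4 * g * g)) \<otimes> x
      = x \<otimes> (c [^] (4 + e * N)) [^] ((1 - 2 * e * g) * (1 + 4 * g * g))"
    by (rule int_pow_commute[rotated -1]) simp_all
  moreover have "(c [^] (4 + e * N)) [^] ((1 - 2 * e * g) * (1 + 4 * g * g)) = c [^] (4::int)"
    unfolding int_pow_pow[OF carr(3)]
  proof (rule cmod[of _ _ "- (2 * g * g * g)"])
    have "(1 + 2 * e * g) * (1 - 2 * e * g) = 1 - 4 * (e * e) * g * g" by (simp add: algebra_simps)
    then have p: "(1 + 2 * e * g) * (1 - 2 * e * g) = 1 - 4 * g * g" using e by simp
    have "(4 + e * N) * ((1 - 2 * e * g) * (1 + 4 * g * g))
        = 4 * ((1 + 2 * e * g) * (1 - 2 * e * g)) * (1 + 4 * g * g)"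
      by (simp add: N algebra_simps)
    also have "\<dots> = 4 + 4 * N * - (2 * g * g * g)"
      unfolding p by (simp add: N algebra_simps)
    finally show "(4 + e * N) * ((1 - 2 * e * g) * (1 + 4 * g * g)) = 4 + 4 * N * - (2 * g * g * g)" .
  qed
  ultimately have c4x: "c [^] (4::int) \<otimes> x = x \<otimes> c [^] (4::int)" by simp
  have comm: "b [^] (2 * j) \<otimes> c [^] (4 * i) = c [^] (4 * i) \<otimes> b [^] (2 * j)" for i j :: int
  proof -
    have "(c [^] (4::int)) [^] i \<otimes> x = x \<otimes> (c [^] (4::int)) [^] i"
      by (rule int_pow_commute) (simp_all add: c4x)
    then have "x [^] j \<otimes> (c [^] (4::int)) [^] i = (c [^] (4::int)) [^] i \<otimes> x [^] j"
      by (intro int_pow_commute[of x]) simp_all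
    then show ?thesis by (simp add: x_def int_pow_pow)
  qed
  have sq: "(c [^] (4 * i) \<otimes> b [^] (2 * j)) [^] (m::int) = c [^] (4 * i * m) \<otimes> b [^] (2 * j * m)" for i j m :: int
    using int_pow_mult_distrib[OF comm[symmetric], of i j m] by (simp add: int_pow_pow)

  have t1: "inv c \<otimes> b [^] (4::int) \<otimes> c = c [^] (2 * N - 8) \<otimes> b [^] (-4::int)"
  proof -
    have "inv c \<otimes> x \<otimes> c = inv c \<otimes> (x \<otimes> c)" by (simp add: m_assoc)
    \<comment> \<open>Because \<open>N = 8g\<close>, the exponent of \<open>c\<close> is a multiple
      of 4 and that of \<open>b\<close> is even. The two factors therefore commute and
      \<open>sq\<close> can raise them separately.\<close>
    also have "\<dots> = c [^] (4 * (-1 + 2 * e * g)) \<otimes> b [^] (2 * (-1 + 4 * g))"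
      unfolding s2 pow1i[OF carr(3)] by (simp add: int_pow_mult_left N algebra_simps)
    finally have "inv c \<otimes> x [^] (2::int) \<otimes> c
        = (c [^] (4 * (-1 + 2 * e * g)) \<otimes> b [^] (2 * (-1 + 4 * g))) [^] (2::int)"
      by (rule int_pow_conj_eq[rotated -1]) simp_all
    also have "\<dots> = c [^] (4 * (-1 + 2 * e * g) * 2) \<otimes> b [^] (2 * (-1 + 4 * g) * 2)"
      by (rule sq)
    also have "b [^] (2 * (-1 + 4 * g) * 2) = b [^] (-4::int)" by (rule bmod[of _ _ 1]) (simp add: N)
    \<comment> \<open>For either sign \<open>e\<close>, the numbers \<open>2eN\<close> and
      \<open>2N\<close> agree modulo \<open>4N\<close>, so the sign disappears on squaring.\<close>
    also have "c [^] (4 * (-1 + 2 * e * g) * 2) = c [^] (2 * N - 8)"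
      using e_cases by (intro cmod[of _ _ "if e = 1 then 0 else -1"]) (auto simp: N)
    finally show ?thesis by (simp add: x_def int_pow_pow)
  qed
  have t2: "c \<otimes> b [^] (4::int) \<otimes> inv c = c [^] (2 * N - 8) \<otimes> b [^] (-4::int)"
  proof -
    \<comment> \<open>Starting from \<open>x^-1\<close> makes \<open>z^-1\<close> appear, to which
      \<open>s3\<close> applies. The power \<open>-2\<close> then restores \<open>b^4\<close> and
      produces the same right side as in \<open>t1\<close>.\<close>
    have "c \<otimes> inv x \<otimes> inv c = c \<otimes> inv z" by (simp add: z_def inv_mult_group m_assoc)
    also have "\<dots> = c [^] (1::int) \<otimes> (c [^] (3 + e * N) \<otimes> b [^] (2 + N))" by (simp add: s3)
    also have "\<dots> = c [^] (4 * (1 + 2 * e * g)) \<otimes> b [^] (2 * (1 + 4 * g))"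
      by (subst int_pow_mult_left) (simp_all add: N algebra_simps)
    finally have "inv (inv c) \<otimes> inv x \<otimes> inv c = c [^] (4 * (1 + 2 * e * g)) \<otimes> b [^] (2 * (1 + 4 * g))"
      by simp
    then have "inv (inv c) \<otimes> inv x [^] (-2::int) \<otimes> inv c
        = (c [^] (4 * (1 + 2 * e * g)) \<otimes> b [^] (2 * (1 + 4 * g))) [^] (-2::int)"
      by (rule int_pow_conj_eq[rotated -1]) simp_all
    also have "\<dots> = c [^] (4 * (1 + 2 * e * g) * -2) \<otimes> b [^] (2 * (1 + 4 * g) * -2)"
      by (rule sq)
    also have "b [^] (2 * (1 + 4 * g) * -2) = b [^] (-4::int)" by (rule bmod[of _ _ "-1"]) (simp add: N)
    also have "c [^] (4 * (1 + 2 * e * g) * -2) = c [^] (2 * N - 8)"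
      using e_cases by (intro cmod[of _ _ "if e = 1 then -1 else 0"]) (auto simp: N)
    finally show ?thesis by (simp add: x_def int_pow_inv int_pow_pow flip: int_pow_neg)
  qed

  define t where "t = b \<otimes> a"
  have [simp]: "t \<in> carrier G" by (simp add: t_def)
  have tinv: "inv t = t" using ba by (intro inv_equality) (simp_all add: t_def)
  have tb: "inv t \<otimes> b [^] (4::int) \<otimes> t = b [^] (4::int)"
  proof -
    have "inv t \<otimes> b [^] (4::int) \<otimes> t = inv a \<otimes> (inv b \<otimes> b [^] (4::int) \<otimes> b) \<otimes> a"
      by (simp add: t_def inv_mult_group m_assoc)
    also have "inv b \<otimes> b [^] (4::int) \<otimes> b = b [^] (4::int)"
      by (rule int_pow_conj_eq) (simp_all add: m_assoc)
    finally show ?thesis using b4a by simp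
  qed
  have tc: "inv t \<otimes> c \<otimes> t = inv c"
  proof -
    have "inv c = t \<otimes> (c \<otimes> t)"
      using cba by (intro inv_equality_right) (simp_all add: m_assoc flip: t_def)
    then show ?thesis by (simp add: tinv m_assoc)
  qed
  have tc': "inv t \<otimes> c [^] i \<otimes> t = c [^] (-i)" for i :: int
    using int_pow_conj_eq[OF _ _ _ tc] by (simp add: int_pow_inv int_pow_neg)
  have tb': "inv t \<otimes> b [^] (-4::int) \<otimes> t = b [^] (-4::int)"
    using int_pow_conj_eq[OF _ _ _ tb, of "-1"] by (simp add: int_pow_pow)
  have hom: "inv t \<otimes> (u \<otimes> v) \<otimes> t = (inv t \<otimes> u \<otimes> t) \<otimes> (inv t \<otimes> v \<otimes> t)"
    if "u \<in> carrier G" "v \<in> carrier G" for u v using that by (simp add: m_assoc)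
  \<comment> \<open>Conjugation by \<open>t\<close> carries the left side of \<open>t1\<close> to
    that of \<open>t2\<close>. On the common right side it fixes the power of \<open>b\<close> and
    inverts the power of \<open>c\<close>.\<close>
  have "c [^] (2 * N - 8) \<otimes> b [^] (-4::int) = c \<otimes> b [^] (4::int) \<otimes> inv c" by (rule t2[symmetric])
  also have "\<dots> = inv t \<otimes> (inv c \<otimes> b [^] (4::int) \<otimes> c) \<otimes> t"
    using tc'[of 1] tc'[of "-1"] tb by (simp add: hom int_pow_neg)
  also have "\<dots> = c [^] (- (2 * N - 8)) \<otimes> b [^] (-4::int)"
    unfolding t1 using tc'[of "2 * N - 8"] tb' by (simp add: hom)
  finally have "c [^] (2 * N - 8) = c [^] (- (2 * N - 8))" by simp
  then have "c [^] (2 * N - 8) \<otimes> c [^] (2 * N - 8) = c [^] (2 * N - 8) \<otimes> c [^] (- (2 * N - 8))" by simp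
  then show ?thesis by (simp flip: int_pow_mult)
qed

end

section \<open>Flags of a polytope\<close>

definition face :: "('a \<Rightarrow> int) \<Rightarrow> 'a set \<Rightarrow> int \<Rightarrow> 'a" where
  "face rk \<Psi> r = (THE x. x \<in> \<Psi> \<and> rk x = r)"

text \<open>Intended for \<open>F\<close> and \<open>G\<close> two ranks apart with \<open>H\<close>
  strictly between them; the diamond condition then makes the description unique.\<close>

definition opposite_face :: "'a set \<Rightarrow> ('a \<Rightarrow> 'a \<Rightarrow> bool) \<Rightarrow> 'a \<Rightarrow> 'a \<Rightarrow> 'a \<Rightarrow> 'a" where
  "opposite_face P leq F H G = (THE K. K \<in> P \<and> leq F K \<and> leq K G \<and> K \<noteq> F \<and> K \<noteq> G \<and> K \<noteq> H)"

locale flagged_polytope =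
  fixes n :: nat and P :: "'a set" and leq :: "'a \<Rightarrow> 'a \<Rightarrow> bool" and rk :: "'a \<Rightarrow> int"
    and \<Phi> :: "'a set"
  assumes polytope: "abstract_polytope n P leq rk"
    and base_flag: "\<Phi> \<in> flags P leq"
begin

abbreviation "adj \<equiv> flag_adj P leq rk"
abbreviation "fc \<equiv> face rk"
abbreviation "A \<equiv> polytope_aut P leq"

lemma leq_refl: "x \<in> P \<Longrightarrow> leq x x"
  using polytope[unfolded abstract_polytope_def, THEN conjunct1]
  by blast

lemma leq_antisym: "\<lbrakk>leq x y; leq y x; x \<in> P; y \<in> P\<rbrakk> \<Longrightarrow> x = y"
  using polytope[unfolded abstract_polytope_def, THEN conjunct2, THEN conjunct1]
  by blast

lemma leq_trans: "\<lbrakk>leq x y; leq y z; x \<in> P; y \<in> P; z \<in> P\<rbrakk> \<Longrightarrow> leq x z"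
  using polytope[unfolded abstract_polytope_def, THEN conjunct2, THEN conjunct2,
      THEN conjunct1]
  by blast

lemma ex_least: "\<exists>m\<in>P. \<forall>x\<in>P. leq m x"
  using polytope[unfolded abstract_polytope_def, THEN conjunct2, THEN conjunct2,
      THEN conjunct2, THEN conjunct1]
  by blast

lemma ex_greatest: "\<exists>m\<in>P. \<forall>x\<in>P. leq x m"
  using polytope[unfolded abstract_polytope_def, THEN conjunct2, THEN conjunct2,
      THEN conjunct2, THEN conjunct2, THEN conjunct1]
  by blast

lemma rk_less: "\<lbrakk>leq x y; x \<noteq> y; x \<in> P; y \<in> P\<rbrakk> \<Longrightarrow> rk x < rk y"
  using polytope[unfolded abstract_polytope_def, THEN conjunct2, THEN conjunct2,
      THEN conjunct2, THEN conjunct2, THEN conjunct2, THEN conjunct1]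
  by blast

lemma flag_bij: "\<Psi> \<in> flags P leq \<Longrightarrow> bij_betw rk \<Psi> {-1..int n}"
  using polytope[unfolded abstract_polytope_def, THEN conjunct2, THEN conjunct2,
      THEN conjunct2, THEN conjunct2, THEN conjunct2, THEN conjunct2, THEN conjunct1]
  by blast

lemma diamond: "\<lbrakk>leq F G; rk G = rk F + 2; F \<in> P; G \<in> P\<rbrakk> \<Longrightarrow>
    card {H \<in> P. leq F H \<and> leq H G \<and> H \<noteq> F \<and> H \<noteq> G} = 2"
  using polytope[unfolded abstract_polytope_def, THEN conjunct2, THEN conjunct2,
      THEN conjunct2, THEN conjunct2, THEN conjunct2, THEN conjunct2, THEN conjunct2,
      THEN conjunct1]
  by blast

lemma connected: "strongly_flag_connected P leq"
  using polytope[unfolded abstract_polytope_def, THEN conjunct2, THEN conjunct2,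
      THEN conjunct2, THEN conjunct2, THEN conjunct2, THEN conjunct2, THEN conjunct2,
      THEN conjunct2]
  by blast

section \<open>Ranks, chains and the extension of chains to flags\<close>

lemma rk_mono: "\<lbrakk>leq x y; x \<in> P; y \<in> P\<rbrakk> \<Longrightarrow> rk x \<le> rk y"
  using rk_less by (cases "x = y") (auto simp: order_less_imp_le)

lemma flag_chain: "\<Psi> \<in> flags P leq \<Longrightarrow> pchain P leq \<Psi>"
  and flag_maximal: "\<lbrakk>\<Psi> \<in> flags P leq; pchain P leq C; \<Psi> \<subseteq> C\<rbrakk> \<Longrightarrow> C = \<Psi>"
  by (auto simp: flags_def)

lemma flag_subset: "\<Psi> \<in> flags P leq \<Longrightarrow> \<Psi> \<subseteq> P"
  using flag_chain by (auto simp: pchain_def)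

lemma chain_leq_iff:
  assumes "pchain P leq C" "x \<in> C" "y \<in> C"
  shows "leq x y \<longleftrightarrow> rk x \<le> rk y"
proof -
  have "leq x y \<or> leq y x" "x \<in> P" "y \<in> P" using assms by (auto simp: pchain_def)
  then show ?thesis using rk_mono[of x y] rk_less[of y x] leq_refl[of x] by (cases "x = y") auto
qed

lemma chain_inj:
  assumes "pchain P leq C"
  shows "inj_on rk C"
proof (rule inj_onI)
  fix x y assume "x \<in> C" "y \<in> C" "rk x = rk y"
  moreover from this have "x \<in> P" "y \<in> P" using assms by (auto simp: pchain_def)
  ultimately show "x = y" using chain_leq_iff[OF assms] leq_antisym by simp
qed

lemma least_in_flag:
  assumes "\<Psi> \<in> flags P leq" "m \<in> P" "\<And>x. x \<in> P \<Longrightarrow> leq m x"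
  shows "m \<in> \<Psi>"
proof -
  have "pchain P leq (insert m \<Psi>)"
    using flag_chain[OF assms(1)] assms(2,3) by (auto simp: pchain_def)
  then show ?thesis using flag_maximal[OF assms(1)] by blast
qed

lemma greatest_in_flag:
  assumes "\<Psi> \<in> flags P leq" "m \<in> P" "\<And>x. x \<in> P \<Longrightarrow> leq x m"
  shows "m \<in> \<Psi>"
proof -
  have "pchain P leq (insert m \<Psi>)"
    using flag_chain[OF assms(1)] assms(2,3) by (auto simp: pchain_def)
  then show ?thesis using flag_maximal[OF assms(1)] by blast
qed

lemma rk_flag: "\<lbrakk>\<Psi> \<in> flags P leq; x \<in> \<Psi>\<rbrakk> \<Longrightarrow> rk x \<in> {-1..int n}"
  using flag_bij bij_betw_apply by metis

text \<open>The least and greatest faces lie in every flag, so the base flag bounds their ranks and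
  monotonicity bounds all others. This is available before any other face is known to lie in a
  flag.\<close>

lemma rk_bounds:
  assumes "x \<in> P" shows "rk x \<in> {-1..int n}"
proof -
  obtain m M where m: "m \<in> P" "\<And>y. y \<in> P \<Longrightarrow> leq m y" and M: "M \<in> P" "\<And>y. y \<in> P \<Longrightarrow> leq y M"
    using ex_least ex_greatest by auto
  have "rk m \<ge> -1" "rk M \<le> int n"
    using rk_flag[OF base_flag least_in_flag[OF base_flag m]]
      rk_flag[OF base_flag greatest_in_flag[OF base_flag M]] by auto
  moreover have "rk m \<le> rk x" "rk x \<le> rk M"
    using rk_mono m M assms by blast+
  ultimately show ?thesis by simp
qed

lemma chain_rk_subset: "pchain P leq C \<Longrightarrow> rk ` C \<subseteq> {-1..int n}"
  using rk_bounds unfolding pchain_def by blast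

text \<open>A further face in a larger chain would share its rank with a face already present,
  contrary to injectivity of the rank on chains.\<close>

lemma flagI:
  assumes "pchain P leq C" "{-1..int n} \<subseteq> rk ` C"
  shows "C \<in> flags P leq"
proof -
  have "D = C" if D: "pchain P leq D" "C \<subseteq> D" for D
  proof (rule ccontr)
    assume "D \<noteq> C"
    then obtain x where x: "x \<in> D" "x \<notin> C" using D(2) by blast
    have "rk x \<in> rk ` C" using chain_rk_subset[OF D(1)] assms(2) x(1) by blast
    then obtain y where "y \<in> C" "rk x = rk y" by blast
    then show False using inj_onD[OF chain_inj[OF D(1)], of x y] x D(2) by blast
  qed
  then show ?thesis using assms(1) by (auto simp: flags_def)
qed

text \<open>Injectivity of the rank limits every chain to \<open>n + 2\<close> faces, so a chain of
  greatest cardinality above \<open>C\<close> exists and is maximal.\<close>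

lemma chain_extends_to_flag:
  assumes "pchain P leq C"
  shows "\<exists>\<Psi>\<in>flags P leq. C \<subseteq> \<Psi>"
proof -
  have bound: "card D \<le> n + 2" if "pchain P leq D" for D
  proof -
    have "card D \<le> card {-1..int n}"
      by (rule card_inj_on_le[OF chain_inj[OF that] chain_rk_subset[OF that]]) simp
    then show ?thesis by simp
  qed
  have fin: "finite D" if "pchain P leq D" for D
    by (rule finite_imageD[OF finite_subset[OF chain_rk_subset[OF that]] chain_inj[OF that]]) simp
  let ?S = "\<lambda>D. pchain P leq D \<and> C \<subseteq> D"
  have "\<exists>D. ?S D \<and> (\<forall>E. ?S E \<longrightarrow> card E \<le> card D)"
  proof (rule ex_has_greatest_nat[of ?S C card "n + 3"])
    show "\<forall>E. ?S E \<longrightarrow> card E < n + 3" using bound by (fastforce dest: bound)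
  qed (use assms in blast)
  then obtain D where D: "?S D" "\<And>E. ?S E \<Longrightarrow> card E \<le> card D" by blast
  have "E = D" if "pchain P leq E" "D \<subseteq> E" for E
    using card_seteq[OF fin[OF that(1)] that(2)] D that by blast
  then have "D \<in> flags P leq" using D(1) by (auto simp: flags_def)
  then show ?thesis using D(1) by blast
qed

lemma face_in_flag:
  assumes "\<Psi> \<in> flags P leq" "-1 \<le> r" "r \<le> int n"
  shows "fc \<Psi> r \<in> \<Psi>" "rk (fc \<Psi> r) = r"
proof -
  have "\<exists>!x. x \<in> \<Psi> \<and> rk x = r"
  proof -
    have "r \<in> rk ` \<Psi>" using flag_bij[OF assms(1)] assms(2,3) by (simp add: bij_betw_def)
    moreover have "inj_on rk \<Psi>" using flag_bij[OF assms(1)] by (simp add: bij_betw_def)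
    ultimately show ?thesis by (auto dest: inj_onD)
  qed
  from theI'[OF this] show "fc \<Psi> r \<in> \<Psi>" "rk (fc \<Psi> r) = r" by (simp_all add: face_def)
qed

lemma face_in_P: "\<lbrakk>\<Psi> \<in> flags P leq; -1 \<le> r; r \<le> int n\<rbrakk> \<Longrightarrow> fc \<Psi> r \<in> P"
  using face_in_flag flag_subset by blast

lemma face_eqI:
  assumes "\<Psi> \<in> flags P leq" "x \<in> \<Psi>" "rk x = r"
  shows "fc \<Psi> r = x"
  unfolding face_def using assms chain_inj[OF flag_chain[OF assms(1)]]
  by (intro the_equality) (auto dest: inj_onD)

lemma flag_eqI:
  assumes "\<Psi> \<in> flags P leq" "\<Omega> \<in> flags P leq" "\<And>r. \<lbrakk>-1 \<le> r; r \<le> int n\<rbrakk> \<Longrightarrow> fc \<Psi> r = fc \<Omega> r"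
  shows "\<Psi> = \<Omega>"
proof -
  have "\<Psi> \<subseteq> \<Omega>"
  proof
    fix x assume "x \<in> \<Psi>"
    moreover from this have "-1 \<le> rk x" "rk x \<le> int n" using rk_flag[OF assms(1)] by auto
    ultimately show "x \<in> \<Omega>" using assms face_eqI[OF assms(1), of x "rk x"] face_in_flag(1) by metis
  qed
  then show ?thesis using flag_maximal[OF assms(1) flag_chain[OF assms(2)]] by simp
qed

lemma face_leq:
  assumes "\<Psi> \<in> flags P leq" "-1 \<le> r" "r \<le> s" "s \<le> int n"
  shows "leq (fc \<Psi> r) (fc \<Psi> s)"
  using chain_leq_iff[OF flag_chain[OF assms(1)]] face_in_flag[OF assms(1)] assms by auto

section \<open>The diamond condition and flag adjacency\<close>

abbreviation "opp \<Psi> j \<equiv> opposite_face P leq (fc \<Psi> (j - 1)) (fc \<Psi> j) (fc \<Psi> (j + 1))"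

lemma opposite_face:
  assumes "\<Psi> \<in> flags P leq" "0 \<le> j" "j < int n"
  shows "opp \<Psi> j \<in> P" "leq (fc \<Psi> (j - 1)) (opp \<Psi> j)" "leq (opp \<Psi> j) (fc \<Psi> (j + 1))"
    "rk (opp \<Psi> j) = j" "opp \<Psi> j \<noteq> fc \<Psi> j"
    and "\<lbrakk>K \<in> P; leq (fc \<Psi> (j - 1)) K; leq K (fc \<Psi> (j + 1)); rk K = j; K \<noteq> fc \<Psi> j\<rbrakk> \<Longrightarrow> K = opp \<Psi> j"
proof -
  let ?F = "fc \<Psi> (j - 1)" and ?H = "fc \<Psi> j" and ?G = "fc \<Psi> (j + 1)"
  let ?S = "{H \<in> P. leq ?F H \<and> leq H ?G \<and> H \<noteq> ?F \<and> H \<noteq> ?G}"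
  have bounds: "-1 \<le> j - 1" "j - 1 \<le> int n" "-1 \<le> j" "j \<le> int n" "-1 \<le> j + 1" "j + 1 \<le> int n"
    using assms(2,3) by simp_all
  have rk: "rk ?F = j - 1" "rk ?H = j" "rk ?G = j + 1"
    by (rule face_in_flag(2)[OF assms(1)], use bounds in simp_all)+
  have P: "?F \<in> P" "?H \<in> P" "?G \<in> P"
    by (rule face_in_P[OF assms(1)], use bounds in simp_all)+
  have le: "leq ?F ?H" "leq ?H ?G" "leq ?F ?G"
    by (rule face_leq[OF assms(1)], use bounds in simp_all)+
  have ne: "?H \<noteq> ?F" "?H \<noteq> ?G" using rk by auto
  have "card ?S = 2"
    using le(3) _ P(1,3) by (rule diamond) (simp add: rk)
  moreover have "?H \<in> ?S" using le P ne by blast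
  moreover have "\<exists>k. S = {h, k} \<and> k \<noteq> h" if "card S = 2" "h \<in> S" for S and h :: 'a
    using that by (auto simp: card_2_iff)
  ultimately obtain K0 where K0: "?S = {?H, K0}" "K0 \<noteq> ?H" by meson
  have K0S: "K0 \<in> ?S" using K0(1) by blast
  have K0D: "K0 \<in> P" "leq ?F K0" "leq K0 ?G" "K0 \<noteq> ?F" "K0 \<noteq> ?G" using K0S by blast+
  have uniq: "K = K0" if "K \<in> P" "leq ?F K" "leq K ?G" "K \<noteq> ?F" "K \<noteq> ?G" "K \<noteq> ?H" for K
  proof -
    have "K \<in> ?S" using that by blast
    then show ?thesis unfolding K0(1) using that(6) by blast
  qed
  have eq: "opp \<Psi> j = K0"
    unfolding opposite_face_def using K0D K0(2) uniq by (intro the_equality) blast+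
  show "opp \<Psi> j \<in> P" "leq ?F (opp \<Psi> j)" "leq (opp \<Psi> j) ?G" "opp \<Psi> j \<noteq> ?H"
    unfolding eq by (fact K0D K0(2))+
  have "rk ?F < rk K0" "rk K0 < rk ?G"
    using rk_less[OF K0D(2) _ P(1) K0D(1)] rk_less[OF K0D(3) _ K0D(1) P(3)] K0D(4,5) by auto
  then show "rk (opp \<Psi> j) = j" unfolding eq rk by simp
  show "K = opp \<Psi> j" if "K \<in> P" "leq ?F K" "leq K ?G" "rk K = j" "K \<noteq> ?H"
    unfolding eq using that(1-3)
  proof (rule uniq)
    show "K \<noteq> ?F" "K \<noteq> ?G" using that(4) rk by auto
  qed (fact that(5))
qed

text \<open>A remaining face of \<Psi> has rank at most \<open>j - 1\<close> or at least
  \<open>j + 1\<close>. Transitivity through the face of \<Psi> of rank \<open>j - 1\<close> or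
  \<open>j + 1\<close> makes it comparable with the new face, and all ranks still occur.\<close>

lemma exchange_flag:
  assumes "\<Psi> \<in> flags P leq" "0 \<le> j" "j < int n"
  defines "\<Omega> \<equiv> insert (opp \<Psi> j) (\<Psi> - {fc \<Psi> j})"
  shows "\<Omega> \<in> flags P leq"
proof (rule flagI)
  note o = opposite_face[OF assms(1-3)]
  note ch = flag_chain[OF assms(1)]
  have comp: "leq x (opp \<Psi> j) \<or> leq (opp \<Psi> j) x" if x: "x \<in> \<Psi>" "x \<noteq> fc \<Psi> j" for x
  proof -
    have xP: "x \<in> P" using flag_subset[OF assms(1)] x(1) by blast
    have "rk x \<noteq> j" using face_eqI[OF assms(1) x(1), of j] x(2) by auto
    then consider "rk x \<le> j - 1" | "j + 1 \<le> rk x" by linarith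
    then show ?thesis
    proof cases
      case 1
      have F: "fc \<Psi> (j - 1) \<in> \<Psi>" "rk (fc \<Psi> (j - 1)) = j - 1" "fc \<Psi> (j - 1) \<in> P"
        using face_in_flag[OF assms(1), of "j - 1"] face_in_P[OF assms(1), of "j - 1"] assms(2,3) by simp_all
      have "leq x (fc \<Psi> (j - 1))"
        using chain_leq_iff[OF ch x(1) F(1)] F(2) 1 by simp
      from leq_trans[OF this o(2) xP F(3) o(1)] show ?thesis ..
    next
      case 2
      have F: "fc \<Psi> (j + 1) \<in> \<Psi>" "rk (fc \<Psi> (j + 1)) = j + 1" "fc \<Psi> (j + 1) \<in> P"
        using face_in_flag[OF assms(1), of "j + 1"] face_in_P[OF assms(1), of "j + 1"] assms(2,3) by simp_all
      have "leq (fc \<Psi> (j + 1)) x"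
        using chain_leq_iff[OF ch F(1) x(1)] F(2) 2 by simp
      from leq_trans[OF o(3) this o(1) F(3) xP] show ?thesis ..
    qed
  qed
  show "pchain P leq \<Omega>"
    unfolding pchain_def
  proof (intro conjI ballI)
    show "\<Omega> \<subseteq> P" using flag_subset[OF assms(1)] o(1) by (auto simp: \<Omega>_def)
    fix x y assume "x \<in> \<Omega>" "y \<in> \<Omega>"
    then show "leq x y \<or> leq y x"
      using comp[of x] comp[of y] leq_refl[OF o(1)] ch unfolding \<Omega>_def pchain_def by blast
  qed
  show "{-1..int n} \<subseteq> rk ` \<Omega>"
  proof
    fix r assume r: "r \<in> {-1..int n}"
    show "r \<in> rk ` \<Omega>"
    proof (cases "r = j")
      case True
      then show ?thesis using o(4) by (auto simp: \<Omega>_def)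
    next
      case False
      then have "fc \<Psi> r \<in> \<Omega>" using face_in_flag[OF assms(1), of r] face_in_flag[OF assms(1), of j] r assms(2,3)
        by (auto simp: \<Omega>_def)
      then show ?thesis using face_in_flag(2)[OF assms(1), of r] r by force
    qed
  qed
qed

text \<open>A different flag with the same faces off rank \<open>j\<close> must have the other face
  of the diamond at rank \<open>j\<close>. It thus contains the exchanged flag and equals it by
  maximality; this is what evaluates the description in \<open>flag_adj\<close>.\<close>

lemma flag_adj_eqI:
  assumes "\<Psi> \<in> flags P leq" "0 \<le> j" "j < int n" "\<Omega> \<in> flags P leq" "\<Omega> \<noteq> \<Psi>"
    "\<And>r. \<lbrakk>-1 \<le> r; r \<le> int n; r \<noteq> j\<rbrakk> \<Longrightarrow> fc \<Omega> r = fc \<Psi> r"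
  shows "\<Omega> = insert (opp \<Psi> j) (\<Psi> - {fc \<Psi> j})" "adj j \<Psi> = \<Omega>"
proof -
  let ?X = "insert (opp \<Psi> j) (\<Psi> - {fc \<Psi> j})"
  have uniq: "\<Theta> = ?X" if T: "\<Theta> \<in> flags P leq" "\<Theta> \<noteq> \<Psi>"
      "\<And>r. \<lbrakk>-1 \<le> r; r \<le> int n; r \<noteq> j\<rbrakk> \<Longrightarrow> fc \<Theta> r = fc \<Psi> r" for \<Theta>
  proof -
    have "fc \<Theta> j \<noteq> fc \<Psi> j" using flag_eqI[OF T(1) assms(1)] T(2,3) by metis
    then have "fc \<Theta> j = opp \<Psi> j"
      using assms(2,3) face_in_P[OF T(1), of j] face_leq[OF T(1), of "j - 1" j] face_leq[OF T(1), of j "j + 1"]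
        face_in_flag(2)[OF T(1), of j] T(3)[of "j - 1"] T(3)[of "j + 1"]
      by (intro opposite_face(6)[OF assms(1-3)]) auto
    then have "opp \<Psi> j \<in> \<Theta>" using face_in_flag(1)[OF T(1), of j] assms(2,3) by simp
    moreover have "x \<in> \<Theta>" if "x \<in> \<Psi> - {fc \<Psi> j}" for x
      using that face_eqI[OF assms(1), of x "rk x"] T(3)[of "rk x"] rk_flag[OF assms(1), of x] face_in_flag(1)[OF T(1), of "rk x"]
      by (cases "rk x = j") auto
    ultimately show ?thesis
      using flag_maximal[OF exchange_flag[OF assms(1-3)] flag_chain[OF T(1)]] by blast
  qed
  show *: "\<Omega> = ?X" using uniq assms by blast
  show "adj j \<Psi> = \<Omega>"
    unfolding flag_adj_def
  proof (rule the_equality)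
    have "x \<in> \<Omega>" if "x \<in> \<Psi>" "rk x \<noteq> j" for x
      using that * face_in_flag(2)[OF assms(1), of j] assms(2,3) by auto
    then show "\<Omega> \<in> flags P leq \<and> \<Omega> \<noteq> \<Psi> \<and> (\<forall>x\<in>\<Psi>. rk x \<noteq> j \<longrightarrow> x \<in> \<Omega>)"
      using assms by blast
    fix \<Theta> assume T: "\<Theta> \<in> flags P leq \<and> \<Theta> \<noteq> \<Psi> \<and> (\<forall>x\<in>\<Psi>. rk x \<noteq> j \<longrightarrow> x \<in> \<Theta>)"
    have "fc \<Theta> r = fc \<Psi> r" if "-1 \<le> r" "r \<le> int n" "r \<noteq> j" for r
      using that T face_in_flag[OF assms(1), of r] by (intro face_eqI) auto
    then show "\<Theta> = \<Omega>" using uniq T * by blast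
  qed
qed

lemma flag_adj:
  assumes "\<Psi> \<in> flags P leq" "0 \<le> j" "j < int n"
  shows "adj j \<Psi> \<in> flags P leq" "adj j \<Psi> \<noteq> \<Psi>"
    "\<lbrakk>-1 \<le> r; r \<le> int n\<rbrakk> \<Longrightarrow> fc (adj j \<Psi>) r = (if r = j then opp \<Psi> j else fc \<Psi> r)"
proof -
  let ?X = "insert (opp \<Psi> j) (\<Psi> - {fc \<Psi> j})"
  note X = exchange_flag[OF assms]
  note o = opposite_face[OF assms]
  have fj: "fc ?X r = (if r = j then opp \<Psi> j else fc \<Psi> r)" if "-1 \<le> r" "r \<le> int n" for r
    using o(4) that face_in_flag[OF assms(1), of r] face_in_flag[OF assms(1), of j] assms(2,3)
    by (intro face_eqI[OF X]) auto
  have ne: "?X \<noteq> \<Psi>"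
  proof
    assume "?X = \<Psi>"
    then have "fc \<Psi> j = opp \<Psi> j" using fj[of j] assms(2,3) by simp
    then show False using o(5) by simp
  qed
  have eq: "adj j \<Psi> = ?X"
    by (rule flag_adj_eqI(2)[OF assms X ne]) (simp add: fj)
  show "adj j \<Psi> \<in> flags P leq" "adj j \<Psi> \<noteq> \<Psi>" unfolding eq by (rule X, rule ne)
  show "fc (adj j \<Psi>) r = (if r = j then opp \<Psi> j else fc \<Psi> r)" if "-1 \<le> r" "r \<le> int n"
    using fj[OF that] by (simp only: eq)
qed

lemma flag_adj_adj:
  assumes "\<Psi> \<in> flags P leq" "0 \<le> j" "j < int n"
  shows "adj j (adj j \<Psi>) = \<Psi>"
  using flag_adj[OF assms] assms by (intro flag_adj_eqI(2)) auto

text \<open>The opposite face at a rank depends only on the faces at that rank and the two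
  neighbouring ranks. For ranks at least two apart, neither exchange affects the data used by the
  other.\<close>

lemma flag_adj_commute:
  assumes "\<Psi> \<in> flags P leq" "0 \<le> i" "i + 2 \<le> j" "j < int n"
  shows "adj i (adj j \<Psi>) = adj j (adj i \<Psi>)"
proof -
  have i: "0 \<le> i" "i < int n" and j: "0 \<le> j" "j < int n" using assms by auto
  note ai = flag_adj[OF assms(1) i] and aj = flag_adj[OF assms(1) j]
  note aij = flag_adj[OF aj(1) i] and aji = flag_adj[OF ai(1) j]
  show ?thesis
    by (rule flag_eqI[OF aij(1) aji(1)])
       (use assms in \<open>auto simp: aij(3) aji(3) ai(3) aj(3)\<close>)
qed

section \<open>The action of automorphisms on flags\<close>

lemma Bij_apply: "f \<in> Bij P \<Longrightarrow> x \<in> P \<Longrightarrow> f x \<in> P"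
  using Bij_imp_funcset by blast

lemma aut_subgroup: "subgroup (carrier A) (BijGroup P)"
proof (rule group.subgroupI[OF group_BijGroup])
  show "carrier A \<subseteq> carrier (BijGroup P)" by (auto simp: polytope_aut_def BijGroup_def)
  have "(\<lambda>x\<in>P. x) \<in> carrier A" by (auto simp: polytope_aut_def id_Bij)
  then show "carrier A \<noteq> {}" by blast
next
  fix f assume f: "f \<in> carrier A"
  then have fB: "f \<in> Bij P" by (simp add: polytope_aut_def)
  have fl: "leq x y \<longleftrightarrow> leq (f x) (f y)" if "x \<in> P" "y \<in> P" for x y
    using f that by (simp add: polytope_aut_def)
  have im: "f ` P = P" using fB by (simp add: Bij_def bij_betw_def)
  have "leq x y \<longleftrightarrow> leq (inv_into P f x) (inv_into P f y)" if "x \<in> P" "y \<in> P" for x y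
    using fl[of "inv_into P f x" "inv_into P f y"] that im
    by (simp add: inv_into_into f_inv_into_f)
  then show "inv\<^bsub>BijGroup P\<^esub> f \<in> carrier A"
    using restrict_inv_into_Bij[OF fB] by (simp add: inv_BijGroup[OF fB] polytope_aut_def)
next
  fix f g assume "f \<in> carrier A" "g \<in> carrier A"
  then show "f \<otimes>\<^bsub>BijGroup P\<^esub> g \<in> carrier A"
    by (simp add: polytope_aut_def BijGroup_def compose_Bij compose_eq Bij_apply)
qed

lemma aut_group: "group A"
proof -
  have "A = (BijGroup P)\<lparr>carrier := carrier A\<rparr>" by (simp add: polytope_aut_def)
  then show ?thesis
    using subgroup.subgroup_is_group[OF aut_subgroup group_BijGroup] by simp
qed

sublocale aut: group A
  by (rule aut_group)

lemma aut_closed: "\<lbrakk>f \<in> carrier A; x \<in> P\<rbrakk> \<Longrightarrow> f x \<in> P"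
  by (simp add: polytope_aut_def Bij_apply)

lemma aut_leq_iff: "\<lbrakk>f \<in> carrier A; x \<in> P; y \<in> P\<rbrakk> \<Longrightarrow> leq (f x) (f y) \<longleftrightarrow> leq x y"
  by (simp add: polytope_aut_def)

lemma aut_inj: "f \<in> carrier A \<Longrightarrow> inj_on f P"
  by (simp add: polytope_aut_def Bij_def bij_betw_def)

lemma aut_mult_apply:
  "\<lbrakk>f \<in> carrier A; g \<in> carrier A; x \<in> P\<rbrakk> \<Longrightarrow> (f \<otimes>\<^bsub>A\<^esub> g) x = f (g x)"
  by (simp add: polytope_aut_def BijGroup_def compose_eq)

lemma aut_one_apply: "x \<in> P \<Longrightarrow> \<one>\<^bsub>A\<^esub> x = x"
  by (simp add: polytope_aut_def BijGroup_def)

text \<open>Elements of \<open>Bij P\<close> are extensional, so their values on \<open>P\<close>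
  determine them as functions.\<close>

lemma aut_eq_oneI:
  assumes "f \<in> carrier A" "\<And>x. x \<in> P \<Longrightarrow> f x = x"
  shows "f = \<one>\<^bsub>A\<^esub>"
proof (rule extensionalityI[of _ P])
  show "f \<in> extensional P" using assms(1) by (simp add: polytope_aut_def Bij_def)
qed (simp_all add: polytope_aut_def BijGroup_def assms(2))

lemma aut_inv_apply:
  assumes "f \<in> carrier A" "x \<in> P"
  shows "(inv\<^bsub>A\<^esub> f) (f x) = x"
  using assms aut_mult_apply[of "inv\<^bsub>A\<^esub> f" f x] by (simp add: aut_one_apply)

lemma aut_mult_image:
  assumes "f \<in> carrier A" "g \<in> carrier A" "\<Psi> \<in> flags P leq"
  shows "(f \<otimes>\<^bsub>A\<^esub> g) ` \<Psi> = f ` g ` \<Psi>"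
  using aut_mult_apply[OF assms(1,2)] flag_subset[OF assms(3)] by (force simp: image_image)

lemma card_flag: "\<Psi> \<in> flags P leq \<Longrightarrow> card \<Psi> = n + 2"
  using bij_betw_same_card[OF flag_bij] by simp

text \<open>Automorphisms are only required to respect the order. The image is a chain with
  \<open>n + 2\<close> faces, and injectivity of the rank forces it to meet every rank.\<close>

lemma aut_flag:
  assumes f: "f \<in> carrier A" and \<Psi>: "\<Psi> \<in> flags P leq"
  shows "f ` \<Psi> \<in> flags P leq"
proof (rule flagI)
  note sub = flag_subset[OF \<Psi>]
  show ch: "pchain P leq (f ` \<Psi>)"
    using flag_chain[OF \<Psi>] aut_closed[OF f] aut_leq_iff[OF f] sub
    by (auto simp: pchain_def subset_iff)
  have "card (rk ` f ` \<Psi>) = card {-1..int n}"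
    using card_image[OF chain_inj[OF ch]] card_image[OF inj_on_subset[OF aut_inj[OF f] sub]] card_flag[OF \<Psi>]
    by simp
  then show "{-1..int n} \<subseteq> rk ` f ` \<Psi>"
    using card_subset_eq[OF _ chain_rk_subset[OF ch]] by simp
qed

text \<open>The faces of a flag below \<open>x\<close> have ranks from \<open>-1\<close> to
  \<open>rk x\<close>, which is \<open>rk x + 2\<close> values. Expressing the rank by the order
  alone is what yields its invariance in \<open>aut_rk\<close>.\<close>

lemma rk_eq_card_below:
  assumes "\<Psi> \<in> flags P leq" "x \<in> \<Psi>"
  shows "rk x = int (card {y \<in> \<Psi>. leq y x}) - 2"
proof -
  have "{y \<in> \<Psi>. leq y x} = {y \<in> \<Psi>. rk y \<le> rk x}"
    using chain_leq_iff[OF flag_chain[OF assms(1)] _ assms(2)] by auto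
  moreover have "bij_betw rk {y \<in> \<Psi>. rk y \<le> rk x} {-1..rk x}"
    unfolding bij_betw_def
  proof
    show "inj_on rk {y \<in> \<Psi>. rk y \<le> rk x}"
      by (rule inj_on_subset[OF chain_inj[OF flag_chain[OF assms(1)]]]) auto
    have "rk ` \<Psi> = {-1..int n}" using flag_bij[OF assms(1)] by (simp add: bij_betw_def)
    moreover have "rk x \<le> int n" using rk_flag[OF assms] by simp
    moreover have "rk ` {y \<in> \<Psi>. rk y \<le> rk x} = rk ` \<Psi> \<inter> {..rk x}" by blast
    ultimately show "rk ` {y \<in> \<Psi>. rk y \<le> rk x} = {-1..rk x}" by auto
  qed
  moreover have "-1 \<le> rk x" using rk_flag[OF assms] by simp
  ultimately show ?thesis using bij_betw_same_card by fastforce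
qed

lemma aut_rk:
  assumes f: "f \<in> carrier A" and \<Psi>: "\<Psi> \<in> flags P leq" and x: "x \<in> \<Psi>"
  shows "rk (f x) = rk x"
proof -
  note sub = flag_subset[OF \<Psi>]
  have "{y \<in> f ` \<Psi>. leq y (f x)} = f ` {y \<in> \<Psi>. leq y x}"
    using aut_leq_iff[OF f] sub x by blast
  then have "card {y \<in> f ` \<Psi>. leq y (f x)} = card {y \<in> \<Psi>. leq y x}"
    using card_image[OF inj_on_subset[OF aut_inj[OF f]], of "{y \<in> \<Psi>. leq y x}"] sub by auto
  then show ?thesis
    using rk_eq_card_below[OF \<Psi> x] rk_eq_card_below[OF aut_flag[OF f \<Psi>], of "f x"] x by simp
qed

lemma aut_face:
  assumes "f \<in> carrier A" "\<Psi> \<in> flags P leq" "-1 \<le> r" "r \<le> int n"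
  shows "fc (f ` \<Psi>) r = f (fc \<Psi> r)"
  using face_in_flag[OF assms(2-4)] aut_rk[OF assms(1,2)]
  by (intro face_eqI[OF aut_flag[OF assms(1,2)]]) auto

lemma aut_flag_adj:
  assumes f: "f \<in> carrier A" and \<Psi>: "\<Psi> \<in> flags P leq" and j: "0 \<le> j" "j < int n"
  shows "f ` adj j \<Psi> = adj j (f ` \<Psi>)"
proof (rule flag_adj_eqI(2)[OF aut_flag[OF f \<Psi>] j, symmetric])
  note a = flag_adj[OF \<Psi> j]
  show "f ` adj j \<Psi> \<in> flags P leq" by (rule aut_flag[OF f a(1)])
  show "f ` adj j \<Psi> \<noteq> f ` \<Psi>"
    using inj_on_image_eq_iff[OF aut_inj[OF f] flag_subset[OF a(1)] flag_subset[OF \<Psi>]] a(2) by simp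
  show "fc (f ` adj j \<Psi>) r = fc (f ` \<Psi>) r" if "-1 \<le> r" "r \<le> int n" "r \<noteq> j" for r
    using aut_face[OF f] a(1) a(3)[OF that(1,2)] \<Psi> that by simp
qed

section \<open>Flag-connectedness and the free action on flags\<close>

lemma flag_extremal_faces:
  assumes "\<Psi> \<in> flags P leq" "\<Omega> \<in> flags P leq"
  shows "fc \<Psi> (-1) \<in> \<Omega>" "fc \<Psi> (int n) \<in> \<Omega>"
proof -
  obtain m M where m: "m \<in> P" "\<And>y. y \<in> P \<Longrightarrow> leq m y" and M: "M \<in> P" "\<And>y. y \<in> P \<Longrightarrow> leq y M"
    using ex_least ex_greatest by auto
  have F: "fc \<Psi> (-1) \<in> P" "rk (fc \<Psi> (-1)) = -1" "fc \<Psi> (int n) \<in> P" "rk (fc \<Psi> (int n)) = int n"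
    using face_in_P[OF assms(1)] face_in_flag(2)[OF assms(1)] by simp_all
  have "rk m = -1"
    using rk_mono[OF m(2)[OF F(1)] m(1) F(1)] rk_bounds[OF m(1)] F(2) by simp
  then have "fc \<Psi> (-1) = m" by (intro face_eqI[OF assms(1) least_in_flag[OF assms(1) m]])
  then show "fc \<Psi> (-1) \<in> \<Omega>" using least_in_flag[OF assms(2) m] by simp
  have "rk M = int n"
    using rk_mono[OF M(2)[OF F(3)] F(3) M(1)] rk_bounds[OF M(1)] F(4) by simp
  then have "fc \<Psi> (int n) = M" by (intro face_eqI[OF assms(1) greatest_in_flag[OF assms(1) M]])
  then show "fc \<Psi> (int n) \<in> \<Omega>" using greatest_in_flag[OF assms(2) M] by simp
qed

text \<open>The index is the rank of the one face of \<Psi> missing from \<Omega>. Ranks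
  \<open>-1\<close> and \<open>n\<close> are excluded because the extremal faces are common to all
  flags.\<close>

lemma adjacent_flags_imp_flag_adj:
  assumes "\<Psi> \<in> flags P leq" "\<Omega> \<in> flags P leq" "adjacent_flags \<Psi> \<Omega>"
  obtains j where "0 \<le> j" "j < int n" "\<Omega> = adj j \<Psi>"
proof -
  obtain x where x: "\<Psi> - \<Omega> = {x}"
    using assms(3) by (auto simp: adjacent_flags_def card_1_singleton_iff)
  then have x\<Psi>: "x \<in> \<Psi>" "x \<notin> \<Omega>" by auto
  have fx: "fc \<Psi> (rk x) = x" by (rule face_eqI[OF assms(1) x\<Psi>(1) refl])
  have "rk x \<noteq> -1" "rk x \<noteq> int n"
    using flag_extremal_faces[OF assms(1,2)] fx x\<Psi>(2) by metis+
  then have j: "0 \<le> rk x" "rk x < int n" using rk_flag[OF assms(1) x\<Psi>(1)] by auto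
  have "adj (rk x) \<Psi> = \<Omega>"
  proof (rule flag_adj_eqI(2)[OF assms(1) j assms(2)])
    show "\<Omega> \<noteq> \<Psi>" using x by auto
    show "fc \<Omega> r = fc \<Psi> r" if "-1 \<le> r" "r \<le> int n" "r \<noteq> rk x" for r
    proof (rule face_eqI[OF assms(2)])
      have "fc \<Psi> r \<noteq> x" using face_in_flag(2)[OF assms(1) that(1,2)] that(3) by auto
      then show "fc \<Psi> r \<in> \<Omega>" using face_in_flag(1)[OF assms(1) that(1,2)] x by blast
    qed (rule face_in_flag(2)[OF assms(1) that(1,2)])
  qed
  then show thesis using that j by blast
qed

lemma adjacent_flag_adj:
  assumes "\<Psi> \<in> flags P leq" "0 \<le> j" "j < int n"
  shows "adjacent_flags \<Psi> (adj j \<Psi>)"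
proof -
  note a = flag_adj[OF assms]
  have "\<Psi> - adj j \<Psi> = {fc \<Psi> j}"
  proof (intro equalityI subsetI)
    fix x assume x: "x \<in> \<Psi> - adj j \<Psi>"
    then have r: "-1 \<le> rk x" "rk x \<le> int n" "fc \<Psi> (rk x) = x"
      using rk_flag[OF assms(1)] face_eqI[OF assms(1)] by auto
    then show "x \<in> {fc \<Psi> j}"
      using face_in_flag(1)[OF a(1) r(1,2)] a(3)[OF r(1,2)] x by (auto split: if_splits)
  next
    fix x assume "x \<in> {fc \<Psi> j}"
    moreover have "fc \<Psi> j \<in> \<Psi>" "rk (fc \<Psi> j) = j" using face_in_flag[OF assms(1)] assms(2,3) by simp_all
    moreover have "fc \<Psi> j \<notin> adj j \<Psi>"
      using face_eqI[OF a(1), of "fc \<Psi> j" j] a(3)[of j] opposite_face(5)[OF assms] assms(2,3) calculation by auto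
    ultimately show "x \<in> \<Psi> - adj j \<Psi>" by simp
  qed
  then show ?thesis by (simp add: adjacent_flags_def)
qed

text \<open>Induction along a path supplied by strong flag-connectedness. The two inclusions in the
  step record that no common face of the end flags is ever exchanged, which restricts the possible
  \<open>j\<close>.\<close>

lemma flag_connected_induct:
  assumes "\<Psi> \<in> flags P leq" "\<Omega> \<in> flags P leq" "Q \<Psi>"
    and step: "\<And>\<Theta> j. \<lbrakk>\<Theta> \<in> flags P leq; 0 \<le> j; j < int n; \<Psi> \<inter> \<Omega> \<subseteq> \<Theta>; \<Psi> \<inter> \<Omega> \<subseteq> adj j \<Theta>; Q \<Theta>\<rbrakk>
      \<Longrightarrow> Q (adj j \<Theta>)"
  shows "Q \<Omega>"
proof -
  from connected assms(1,2) obtain xs where xs: "xs \<noteq> []" "hd xs = \<Psi>" "last xs = \<Omega>"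
    "set xs \<subseteq> flags P leq" "\<And>i. Suc i < length xs \<Longrightarrow> adjacent_flags (xs ! i) (xs ! Suc i)"
    "\<And>\<Theta>. \<Theta> \<in> set xs \<Longrightarrow> \<Psi> \<inter> \<Omega> \<subseteq> \<Theta>"
    unfolding strongly_flag_connected_def by meson
  have "Q (xs ! i)" if "i < length xs" for i
    using that
  proof (induction i)
    case 0
    then show ?case using xs(1,2) assms(3) by (simp add: hd_conv_nth)
  next
    case (Suc i)
    have mem: "xs ! i \<in> set xs" "xs ! Suc i \<in> set xs" using Suc.prems by simp_all
    obtain j where j: "0 \<le> j" "j < int n" "xs ! Suc i = adj j (xs ! i)"
      using adjacent_flags_imp_flag_adj[OF _ _ xs(5)[OF Suc.prems]] mem xs(4) by blast
    have "Q (adj j (xs ! i))"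
    proof (rule step[OF _ j(1,2)])
      show "xs ! i \<in> flags P leq" using mem(1) xs(4) by blast
      show "\<Psi> \<inter> \<Omega> \<subseteq> xs ! i" by (rule xs(6)[OF mem(1)])
      show "\<Psi> \<inter> \<Omega> \<subseteq> adj j (xs ! i)" using xs(6)[OF mem(2)] j(3) by simp
      show "Q (xs ! i)" using Suc by simp
    qed
    then show ?case using j(3) by simp
  qed
  from this[of "length xs - 1"] show ?thesis using xs(1,3) by (simp add: last_conv_nth)
qed

text \<open>An automorphism commutes with adjacency, so fixing one flag makes it fix all flags by
  connectedness, and every face lies in a flag.\<close>

lemma aut_free:
  assumes f: "f \<in> carrier A" and fixed: "f ` \<Phi> = \<Phi>"
  shows "f = \<one>\<^bsub>A\<^esub>"
proof (rule aut_eq_oneI[OF f])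
  fix x assume x: "x \<in> P"
  then have "pchain P leq {x}" using leq_refl by (simp add: pchain_def)
  then obtain \<Theta> where \<Theta>: "\<Theta> \<in> flags P leq" "x \<in> \<Theta>" using chain_extends_to_flag by blast
  have "f ` \<Theta> = \<Theta>"
    by (rule flag_connected_induct[OF base_flag \<Theta>(1)]) (simp_all add: fixed aut_flag_adj[OF f])
  moreover have "fc \<Theta> (rk x) = x" by (rule face_eqI[OF \<Theta> refl])
  moreover have "fc (f ` \<Theta>) (rk x) = f (fc \<Theta> (rk x))"
    using aut_face[OF f \<Theta>(1)] rk_flag[OF \<Theta>] by simp
  ultimately show "f x = x" by simp
qed

section \<open>Standard generators\<close>

text \<open>The distinct powers of \<open>s\<close> correspond to the images of the base face of
  rank \<open>i - 1\<close>: the orbit is the whole set of such faces in the section, and the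
  stabilizer is trivial.\<close>

lemma generator_ord:
  assumes chiral: "\<And>\<Psi> \<Omega> f. \<lbrakk>\<Psi> \<in> flags P leq; \<Omega> \<in> flags P leq; adjacent_flags \<Psi> \<Omega>; f \<in> carrier A\<rbrakk>
      \<Longrightarrow> f ` \<Psi> \<noteq> \<Omega>"
    and i: "1 \<le> i" "i < int n"
    and s: "s \<in> carrier A" and gen: "s ` \<Phi> = adj (i - 1) (adj i \<Phi>)"
  shows "aut.ord s = card {H \<in> P. leq (fc \<Phi> (i - 2)) H \<and> leq H (fc \<Phi> (i + 1)) \<and> rk H = i - 1}"
proof -
  let ?x = "fc \<Phi> (i - 1)" and ?F = "fc \<Phi> (i - 2)" and ?G = "fc \<Phi> (i + 1)"
  let ?S = "{H \<in> P. leq ?F H \<and> leq H ?G \<and> rk H = i - 1}"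
  have ib: "0 \<le> i" "i < int n" "0 \<le> i - 1" "i - 1 < int n" using i by auto
  have xP: "?x \<in> P" and rkx: "rk ?x = i - 1"
    using face_in_P[OF base_flag] face_in_flag(2)[OF base_flag] ib by simp_all
  note sk = aut.int_pow_closed[OF s]
  note fl = aut_flag[OF sk base_flag]
  have ai: "adj i \<Psi> \<in> flags P leq" if "\<Psi> \<in> flags P leq" for \<Psi>
    using flag_adj(1)[OF that ib(1,2)] .

  have step: "(s [^]\<^bsub>A\<^esub> (k + 1)) ` \<Phi> = adj (i - 1) (adj i ((s [^]\<^bsub>A\<^esub> k) ` \<Phi>))" for k :: int
  proof -
    have "s [^]\<^bsub>A\<^esub> (k + 1) = s [^]\<^bsub>A\<^esub> k \<otimes>\<^bsub>A\<^esub> s"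
      using aut.int_pow_mult[OF s, of k 1] s by simp
    then have "(s [^]\<^bsub>A\<^esub> (k + 1)) ` \<Phi> = (s [^]\<^bsub>A\<^esub> k) ` adj (i - 1) (adj i \<Phi>)"
      using aut_mult_image[OF sk s base_flag] gen by simp
    then show ?thesis
      using aut_flag_adj[OF sk ai[OF base_flag] ib(3,4)] aut_flag_adj[OF sk base_flag ib(1,2)] by simp
  qed

  have fixed: "(s [^]\<^bsub>A\<^esub> k) (fc \<Phi> r) = fc \<Phi> r"
    if r: "-1 \<le> r" "r \<le> int n" "r \<noteq> i" "r \<noteq> i - 1" for r and k :: int
  proof -
    have "fc (s ` \<Phi>) r = fc \<Phi> r"
      unfolding gen using flag_adj(3)[OF ai[OF base_flag] ib(3,4) r(1,2)] flag_adj(3)[OF base_flag ib(1,2) r(1,2)] r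
      by simp
    then have sr: "s (fc \<Phi> r) = fc \<Phi> r" using aut_face[OF s base_flag r(1,2)] by simp
    have rP: "fc \<Phi> r \<in> P" by (rule face_in_P[OF base_flag r(1,2)])
    \<comment> \<open>Passing to the stabilizer subgroup covers negative powers of \<open>s\<close>
      as well.\<close>
    have "subgroup {f \<in> carrier A. f (fc \<Phi> r) = fc \<Phi> r} A"
    proof (rule aut.subgroupI)
      show "{f \<in> carrier A. f (fc \<Phi> r) = fc \<Phi> r} \<noteq> {}" using s sr by blast
      show "inv\<^bsub>A\<^esub> f \<in> {f \<in> carrier A. f (fc \<Phi> r) = fc \<Phi> r}"
        if "f \<in> {f \<in> carrier A. f (fc \<Phi> r) = fc \<Phi> r}" for f
        using that aut_inv_apply[of f "fc \<Phi> r"] rP by simp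
    qed (auto simp: aut_mult_apply rP)
    from aut.subgroup_int_pow_closed[OF this] show ?thesis using s sr by blast
  qed

  \<comment> \<open>Such a power fixes every base face except possibly the one of rank
    \<open>i\<close>. If it moved \<Phi>, it would send it to the \<open>i\<close>-adjacent flag,
    against chirality.\<close>
  have stabilizer: "s [^]\<^bsub>A\<^esub> k = \<one>\<^bsub>A\<^esub>" if k: "(s [^]\<^bsub>A\<^esub> k) ?x = ?x" for k :: int
  proof (rule aut_free[OF sk], rule ccontr)
    let ?\<Omega> = "(s [^]\<^bsub>A\<^esub> k) ` \<Phi>"
    assume ne: "?\<Omega> \<noteq> \<Phi>"
    have "fc ?\<Omega> r = fc \<Phi> r" if r: "-1 \<le> r" "r \<le> int n" "r \<noteq> i" for r
      using aut_face[OF sk base_flag r(1,2)] fixed[OF r] k by (cases "r = i - 1") auto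
    then have "adj i \<Phi> = ?\<Omega>" by (intro flag_adj_eqI(2)[OF base_flag ib(1,2) fl ne])
    then show False
      using chiral[OF base_flag ai[OF base_flag] adjacent_flag_adj[OF base_flag ib(1,2)] sk[of k]] by simp
  qed

  have orbit: "\<exists>k::int. H = (s [^]\<^bsub>A\<^esub> k) ?x" if "H \<in> ?S" for H
  proof -
    have H: "H \<in> P" "leq ?F H" "leq H ?G" "rk H = i - 1" using that by auto
    \<comment> \<open>Completing \<open>H\<close> and these faces to a flag keeps the path from
      \<Phi> inside the section: only exchanges at ranks \<open>i\<close> and \<open>i - 1\<close>
      can occur.\<close>
    let ?C = "{y \<in> \<Phi>. rk y \<noteq> i \<and> rk y \<noteq> i - 1}"
    note sub = flag_subset[OF base_flag] and ch = flag_chain[OF base_flag]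
    have F: "?F \<in> \<Phi>" "rk ?F = i - 2" "?G \<in> \<Phi>" "rk ?G = i + 1"
      using face_in_flag[OF base_flag] i by simp_all
    have comp: "leq y H \<or> leq H y" if y: "y \<in> ?C" for y
    proof -
      have y\<Phi>: "y \<in> \<Phi>" and "rk y \<noteq> i" "rk y \<noteq> i - 1" using y by auto
      then consider "rk y \<le> i - 2" | "i + 1 \<le> rk y" by linarith
      then show ?thesis
      proof cases
        case 1
        then have "leq y ?F" using chain_leq_iff[OF ch y\<Phi> F(1)] F(2) by simp
        from leq_trans[OF this H(2) _ _ H(1)] show ?thesis using y\<Phi> F(1) sub by blast
      next
        case 2
        then have "leq ?G y" using chain_leq_iff[OF ch F(3) y\<Phi>] F(4) by simp
        from leq_trans[OF H(3) this H(1)] show ?thesis using y\<Phi> F(3) sub by blast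
      qed
    qed
    have "pchain P leq (insert H ?C)"
      unfolding pchain_def
    proof (intro conjI ballI)
      show "insert H ?C \<subseteq> P" using sub H(1) by blast
      fix y z assume "y \<in> insert H ?C" "z \<in> insert H ?C"
      then show "leq y z \<or> leq z y"
        using comp[of y] comp[of z] leq_refl[OF H(1)] ch unfolding pchain_def by blast
    qed
    then obtain \<Psi> where \<Psi>: "\<Psi> \<in> flags P leq" "insert H ?C \<subseteq> \<Psi>"
      using chain_extends_to_flag by blast
    \<comment> \<open>Alternating the two adjacencies from \<Phi> reaches exactly the images of
      \<Phi> under powers of \<open>s\<close> and their \<open>i\<close>-adjacent flags.\<close>
    let ?Q = "\<lambda>\<Theta>. \<exists>k::int. \<Theta> = (s [^]\<^bsub>A\<^esub> k) ` \<Phi> \<or> \<Theta> = adj i ((s [^]\<^bsub>A\<^esub> k) ` \<Phi>)"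
    have "?Q \<Psi>"
    proof (rule flag_connected_induct[where Q = ?Q, OF base_flag \<Psi>(1)])
      have "\<Phi> = (s [^]\<^bsub>A\<^esub> (0::int)) ` \<Phi>"
        using aut_one_apply sub by (force simp: subset_iff)
      then show "?Q \<Phi>" by blast
    next
      fix \<Theta> j
      assume \<Theta>: "\<Theta> \<in> flags P leq" and j: "0 \<le> j" "j < int n"
        and in1: "\<Phi> \<inter> \<Psi> \<subseteq> \<Theta>" and in2: "\<Phi> \<inter> \<Psi> \<subseteq> adj j \<Theta>" and Q: "?Q \<Theta>"
      note aj = flag_adj[OF \<Theta> j]
      \<comment> \<open>Any other \<open>j\<close> would exchange a face shared by \<Phi> and
        \<Psi>, since \<open>?C\<close> lies in both.\<close>
      have "j = i \<or> j = i - 1"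
      proof (rule ccontr)
        assume "\<not> (j = i \<or> j = i - 1)"
        moreover have fj: "fc \<Phi> j \<in> \<Phi>" "rk (fc \<Phi> j) = j" using face_in_flag[OF base_flag] j by simp_all
        ultimately have "fc \<Phi> j \<in> \<Phi> \<inter> \<Psi>" using \<Psi>(2) by auto
        then have "fc \<Theta> j = fc \<Phi> j" "fc (adj j \<Theta>) j = fc \<Phi> j"
          using face_eqI[OF \<Theta> _ fj(2)] face_eqI[OF aj(1) _ fj(2)] in1 in2 by blast+
        then show False using aj(3)[of j] opposite_face(5)[OF \<Theta> j] j by simp
      qed
      moreover from Q obtain k :: int where
        k: "\<Theta> = (s [^]\<^bsub>A\<^esub> k) ` \<Phi> \<or> \<Theta> = adj i ((s [^]\<^bsub>A\<^esub> k) ` \<Phi>)" by blast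
      moreover have "adj (i - 1) ((s [^]\<^bsub>A\<^esub> k) ` \<Phi>) = adj i ((s [^]\<^bsub>A\<^esub> (k - 1)) ` \<Phi>)"
        using step[of "k - 1"] flag_adj_adj[OF ai[OF fl] ib(3,4)] by simp
      moreover have "adj i (adj i ((s [^]\<^bsub>A\<^esub> k) ` \<Phi>)) = (s [^]\<^bsub>A\<^esub> k) ` \<Phi>"
        by (rule flag_adj_adj[OF fl ib(1,2)])
      ultimately show "?Q (adj j \<Theta>)" using step[of k] by metis
    qed
    then obtain k :: int where k: "\<Psi> = (s [^]\<^bsub>A\<^esub> k) ` \<Phi> \<or> \<Psi> = adj i ((s [^]\<^bsub>A\<^esub> k) ` \<Phi>)" by blast
    have "H = fc \<Psi> (i - 1)" using face_eqI[OF \<Psi>(1) _ H(4)] \<Psi>(2) by simp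
    \<comment> \<open>Both alternatives have the same face of rank \<open>i - 1\<close>, because
      \<open>adj i\<close> changes only rank \<open>i\<close>.\<close>
    also have "\<dots> = fc ((s [^]\<^bsub>A\<^esub> k) ` \<Phi>) (i - 1)"
      using k flag_adj(3)[OF fl ib(1,2), of "i - 1"] ib by auto
    also have "\<dots> = (s [^]\<^bsub>A\<^esub> k) ?x" using aut_face[OF sk base_flag] ib by simp
    finally show ?thesis by blast
  qed

  have "bij_betw (\<lambda>f. f ?x) {s [^]\<^bsub>A\<^esub> k |k. k \<in> (UNIV :: int set)} ?S"
    unfolding bij_betw_def
  proof
    show "inj_on (\<lambda>f. f ?x) {s [^]\<^bsub>A\<^esub> k |k. k \<in> (UNIV :: int set)}"
    proof (rule inj_onI, clarify)
      fix k l :: int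
      assume eq: "(s [^]\<^bsub>A\<^esub> k) ?x = (s [^]\<^bsub>A\<^esub> l) ?x"
      have "(s [^]\<^bsub>A\<^esub> (- l + k)) ?x = (s [^]\<^bsub>A\<^esub> (- l)) ((s [^]\<^bsub>A\<^esub> k) ?x)"
        unfolding aut.int_pow_mult[OF s] by (rule aut_mult_apply[OF sk sk xP])
      also have "\<dots> = ?x"
        unfolding eq using aut_inv_apply[OF sk xP] aut.int_pow_neg[OF s] by simp
      finally have "s [^]\<^bsub>A\<^esub> (- l + k) = \<one>\<^bsub>A\<^esub>" by (rule stabilizer)
      then have "s [^]\<^bsub>A\<^esub> l \<otimes>\<^bsub>A\<^esub> s [^]\<^bsub>A\<^esub> (- l + k) = s [^]\<^bsub>A\<^esub> l" using sk by simp
      then show "s [^]\<^bsub>A\<^esub> k = s [^]\<^bsub>A\<^esub> l" using s by (simp flip: aut.int_pow_mult)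
    qed
    have "(s [^]\<^bsub>A\<^esub> k) ?x \<in> ?S" for k :: int
    proof -
      have "leq ((s [^]\<^bsub>A\<^esub> k) ?F) ((s [^]\<^bsub>A\<^esub> k) ?x)" "leq ((s [^]\<^bsub>A\<^esub> k) ?x) ((s [^]\<^bsub>A\<^esub> k) ?G)"
        using aut_leq_iff[OF sk] face_in_P[OF base_flag] face_leq[OF base_flag] xP i by simp_all
      moreover have "(s [^]\<^bsub>A\<^esub> k) ?F = ?F" "(s [^]\<^bsub>A\<^esub> k) ?G = ?G"
        using i by (auto intro!: fixed)
      moreover have "rk ((s [^]\<^bsub>A\<^esub> k) ?x) = i - 1"
        using aut_rk[OF sk base_flag] face_in_flag[OF base_flag] ib by simp
      ultimately show ?thesis using aut_closed[OF sk xP] by simp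
    qed
    then show "(\<lambda>f. f ?x) ` {s [^]\<^bsub>A\<^esub> k |k. k \<in> (UNIV :: int set)} = ?S"
      using orbit by blast
  qed
  from bij_betw_same_card[OF this] show ?thesis
    using aut.generate_pow_card[OF s] aut.generate_pow[OF s] by simp
qed

text \<open>The inner adjacencies cancel, so each product moves \<Phi> by two adjacencies at ranks
  at least two apart. These commute, so the square fixes \<Phi> and \<open>aut_free\<close>
  applies.\<close>

lemma generator_relations:
  assumes n: "n = 4"
    and s: "s1 \<in> carrier A" "s2 \<in> carrier A" "s3 \<in> carrier A"
    and g1: "s1 ` \<Phi> = adj 0 (adj 1 \<Phi>)" and g2: "s2 ` \<Phi> = adj 1 (adj 2 \<Phi>)"
    and g3: "s3 ` \<Phi> = adj 2 (adj 3 \<Phi>)"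
  shows "s2 \<otimes>\<^bsub>A\<^esub> s1 \<otimes>\<^bsub>A\<^esub> (s2 \<otimes>\<^bsub>A\<^esub> s1) = \<one>\<^bsub>A\<^esub>"
    and "s3 \<otimes>\<^bsub>A\<^esub> s2 \<otimes>\<^bsub>A\<^esub> (s3 \<otimes>\<^bsub>A\<^esub> s2) = \<one>\<^bsub>A\<^esub>"
    and "s3 \<otimes>\<^bsub>A\<^esub> (s2 \<otimes>\<^bsub>A\<^esub> s1) \<otimes>\<^bsub>A\<^esub> (s3 \<otimes>\<^bsub>A\<^esub> (s2 \<otimes>\<^bsub>A\<^esub> s1)) = \<one>\<^bsub>A\<^esub>"
proof -
  have fl: "adj j \<Psi> \<in> flags P leq" if "\<Psi> \<in> flags P leq" "0 \<le> j" "j < 4" for \<Psi> j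
    using flag_adj(1)[OF that(1,2)] that(3) n by simp
  have aa: "adj j (adj j \<Psi>) = \<Psi>" if "\<Psi> \<in> flags P leq" "0 \<le> j" "j < 4" for \<Psi> j
    using flag_adj_adj[OF that(1,2)] that(3) n by simp
  have au: "f ` adj j \<Psi> = adj j (f ` \<Psi>)" if "f \<in> carrier A" "\<Psi> \<in> flags P leq" "0 \<le> j" "j < 4" for \<Psi> j f
    using aut_flag_adj[OF that(1-3)] that(4) n by simp
  note B = base_flag
  have involution: "f \<otimes>\<^bsub>A\<^esub> f = \<one>\<^bsub>A\<^esub>"
    if f: "f \<in> carrier A" and fi: "f ` \<Phi> = adj i (adj j \<Phi>)" and ij: "0 \<le> i" "i + 2 \<le> j" "j < 4" for f i j
  proof (rule aut_free)
    have "(f \<otimes>\<^bsub>A\<^esub> f) ` \<Phi> = f ` adj i (adj j \<Phi>)" using aut_mult_image[OF f f B] fi by simp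
    also have "\<dots> = adj i (adj j (adj i (adj j \<Phi>)))" using au f fl B ij fi by simp
    also have "adj i (adj j \<Phi>) = adj j (adj i \<Phi>)" using flag_adj_commute[OF B ij(1,2)] ij(3) n by simp
    also have "adj i (adj j (adj j (adj i \<Phi>))) = \<Phi>" using aa fl B ij by simp
    finally show "(f \<otimes>\<^bsub>A\<^esub> f) ` \<Phi> = \<Phi>" .
  qed (use f in simp)
  have i21: "(s2 \<otimes>\<^bsub>A\<^esub> s1) ` \<Phi> = adj 0 (adj 2 \<Phi>)"
    using aut_mult_image[OF s(2,1) B] by (simp add: g1 g2 au s fl B aa)
  have i32: "(s3 \<otimes>\<^bsub>A\<^esub> s2) ` \<Phi> = adj 1 (adj 3 \<Phi>)"
    using aut_mult_image[OF s(3,2) B] by (simp add: g2 g3 au s fl B aa)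
  have i321: "(s3 \<otimes>\<^bsub>A\<^esub> (s2 \<otimes>\<^bsub>A\<^esub> s1)) ` \<Phi> = adj 0 (adj 3 \<Phi>)"
    using aut_mult_image[OF s(3) _ B, of "s2 \<otimes>\<^bsub>A\<^esub> s1"] by (simp add: i21 g3 au s fl B aa)
  show "s2 \<otimes>\<^bsub>A\<^esub> s1 \<otimes>\<^bsub>A\<^esub> (s2 \<otimes>\<^bsub>A\<^esub> s1) = \<one>\<^bsub>A\<^esub>"
    by (rule involution[OF _ i21]) (use s in simp_all)
  show "s3 \<otimes>\<^bsub>A\<^esub> s2 \<otimes>\<^bsub>A\<^esub> (s3 \<otimes>\<^bsub>A\<^esub> s2) = \<one>\<^bsub>A\<^esub>"
    by (rule involution[OF _ i32]) (use s in simp_all)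
  show "s3 \<otimes>\<^bsub>A\<^esub> (s2 \<otimes>\<^bsub>A\<^esub> s1) \<otimes>\<^bsub>A\<^esub> (s3 \<otimes>\<^bsub>A\<^esub> (s2 \<otimes>\<^bsub>A\<^esub> s1)) = \<one>\<^bsub>A\<^esub>"
    by (rule involution[OF _ i321]) (use s in simp_all)
qed

end

section \<open>Orders from the type contradict the relations\<close>

theorem theorem5p13:
  fixes P :: "'a set" and leq :: "'a \<Rightarrow> 'a \<Rightarrow> bool" and rk :: "'a \<Rightarrow> int"
    and \<Phi> :: "'a set" and s1 s2 s3 :: "'a \<Rightarrow> 'a"
    and \<beta> :: nat and e1 e2 :: int
  assumes "\<beta> \<ge> 5" and "e1 \<in> {0, 1}" and "e2 \<in> {1, -1}"
  shows "\<not> (chiral_polytope 4 P leq rk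
           \<and> has_type 4 P leq rk [2 ^ (\<beta> - 2), 2 ^ (\<beta> - 1), 2 ^ \<beta>]
           \<and> finite (flags P leq)
           \<and> card (flags P leq) = 2 * (2 ^ (\<beta> - 2) * 2 ^ (\<beta> - 1) * 2 ^ \<beta>)
           \<and> \<Phi> \<in> flags P leq
           \<and> standard_generator P leq rk \<Phi> 1 s1
           \<and> standard_generator P leq rk \<Phi> 2 s2
           \<and> standard_generator P leq rk \<Phi> 3 s3
           \<and> rprod (polytope_aut P leq) s2 (inv\<^bsub>polytope_aut P leq\<^esub> s1)
               = rprod (polytope_aut P leq) s1 (s2 [^]\<^bsub>polytope_aut P leq\<^esub> (3 - e1 * 2 ^ (\<beta> - 2)))
           \<and> rprod (polytope_aut P leq) (inv\<^bsub>polytope_aut P leq\<^esub> s3) s2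
               = rprod (polytope_aut P leq)
                   (s2 [^]\<^bsub>polytope_aut P leq\<^esub> (-1 + (2::int) ^ (\<beta> - 2)))
                   (s3 [^]\<^bsub>polytope_aut P leq\<^esub> (-3 + e2 * 2 ^ (\<beta> - 2)))
           \<and> rprod (polytope_aut P leq) s3 (inv\<^bsub>polytope_aut P leq\<^esub> s2)
               = rprod (polytope_aut P leq)
                   (s2 [^]\<^bsub>polytope_aut P leq\<^esub> (1 + (2::int) ^ (\<beta> - 2)))
                   (s3 [^]\<^bsub>polytope_aut P leq\<^esub> (3 + e2 * 2 ^ (\<beta> - 2))))"
proof (intro notI, elim conjE)
  assume ch: "chiral_polytope 4 P leq rk"
    and ty: "has_type 4 P leq rk [2 ^ (\<beta> - 2), 2 ^ (\<beta> - 1), 2 ^ \<beta>]"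
    and base: "\<Phi> \<in> flags P leq"
    and sg: "standard_generator P leq rk \<Phi> 1 s1" "standard_generator P leq rk \<Phi> 2 s2"
      "standard_generator P leq rk \<Phi> 3 s3"
    and r1: "rprod (polytope_aut P leq) s2 (inv\<^bsub>polytope_aut P leq\<^esub> s1)
               = rprod (polytope_aut P leq) s1 (s2 [^]\<^bsub>polytope_aut P leq\<^esub> (3 - e1 * 2 ^ (\<beta> - 2)))"
    and r2: "rprod (polytope_aut P leq) (inv\<^bsub>polytope_aut P leq\<^esub> s3) s2
               = rprod (polytope_aut P leq)
                   (s2 [^]\<^bsub>polytope_aut P leq\<^esub> (-1 + (2::int) ^ (\<beta> - 2)))
                   (s3 [^]\<^bsub>polytope_aut P leq\<^esub> (-3 + e2 * 2 ^ (\<beta> - 2)))"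
    and r3: "rprod (polytope_aut P leq) s3 (inv\<^bsub>polytope_aut P leq\<^esub> s2)
               = rprod (polytope_aut P leq)
                   (s2 [^]\<^bsub>polytope_aut P leq\<^esub> (1 + (2::int) ^ (\<beta> - 2)))
                   (s3 [^]\<^bsub>polytope_aut P leq\<^esub> (3 + e2 * 2 ^ (\<beta> - 2)))"
  interpret flagged_polytope 4 P leq rk \<Phi>
    using ch base by unfold_locales (simp_all add: chiral_polytope_def)
  have s: "s1 \<in> carrier A" "s2 \<in> carrier A" "s3 \<in> carrier A"
    and g: "s1 ` \<Phi> = adj 0 (adj 1 \<Phi>)" "s2 ` \<Phi> = adj 1 (adj 2 \<Phi>)" "s3 ` \<Phi> = adj 2 (adj 3 \<Phi>)"
    using sg by (simp_all add: standard_generator_def)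
  note rels = generator_relations[OF refl s g]
  have chiral: "f ` \<Psi> \<noteq> \<Omega>"
    if "\<Psi> \<in> flags P leq" "\<Omega> \<in> flags P leq" "adjacent_flags \<Psi> \<Omega>" "f \<in> carrier A" for \<Psi> \<Omega> f
    using ch that unfolding chiral_polytope_def by blast
  have section_card: "card {H \<in> P. leq (fc \<Phi> (int j - 2)) H \<and> leq H (fc \<Phi> (int j + 1)) \<and> rk H = int j - 1}
      = [2 ^ (\<beta> - 2), 2 ^ (\<beta> - 1), 2 ^ \<beta>] ! (j - 1)" if "j \<in> {1..3}" for j
  proof -
    have "fc \<Phi> (int j - 2) \<in> P" "fc \<Phi> (int j + 1) \<in> P" "leq (fc \<Phi> (int j - 2)) (fc \<Phi> (int j + 1))"
      "rk (fc \<Phi> (int j - 2)) = int j - 2" "rk (fc \<Phi> (int j + 1)) = int j + 1"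
      using that base_flag by (auto intro!: face_in_P face_leq face_in_flag(2))
    then show ?thesis using ty that unfolding has_type_def by auto
  qed
  have ord2: "aut.ord s2 = 2 ^ (\<beta> - 1)"
    using generator_ord[OF chiral _ _ s(2), of 2] section_card[of 2] g(2) by simp
  have ord3: "aut.ord s3 = 2 ^ \<beta>"
    using generator_ord[OF chiral _ _ s(3), of 3] section_card[of 3] g(3) by (simp add: numeral_eq_Suc)
  define N :: int where "N = 2 ^ (\<beta> - 2)"
  \<comment> \<open>The bound on \<beta> enters here: it makes \<open>N\<close> a multiple of 8,
    with \<open>g = 2 ^ m\<close> in \<open>pow_eq_one_of_relations\<close>. The orders of
    \<open>s2\<close> and \<open>s3\<close> are then \<open>2N\<close> and
    \<open>4N\<close>.\<close>
  obtain m where m: "\<beta> = m + 5" using assms(1) by (metis add.commute le_Suc_ex)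
  have N: "N = 8 * 2 ^ m" by (simp add: N_def m numeral_eq_Suc)
  have "s3 [^]\<^bsub>A\<^esub> (4 * N - 16) = \<one>\<^bsub>A\<^esub>"
  proof (rule aut.pow_eq_one_of_relations[OF s N _ _ _ rels])
    show "e2 * e2 = 1" using assms(3) by auto
    show "s2 [^]\<^bsub>A\<^esub> (2 * N) = \<one>\<^bsub>A\<^esub>"
      by (simp add: aut.int_pow_eq_id[OF s(2)] ord2 N m power_add)
    show "s3 [^]\<^bsub>A\<^esub> (4 * N) = \<one>\<^bsub>A\<^esub>"
      by (simp add: aut.int_pow_eq_id[OF s(3)] ord3 N m power_add)
  qed (use r1 r2 r3 in \<open>simp_all add: rprod_def N_def\<close>)
  then have "int (2 ^ \<beta>) dvd 4 * N - 16"
    by (simp add: aut.int_pow_eq_id[OF s(3)] ord3)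
  then have "32 * 2 ^ m dvd (32 * 2 ^ m - 16 :: int)" by (simp add: N m power_add mult.commute)
  \<comment> \<open>Here \<open>32 * 2 ^ m\<close> is \<open>4N\<close>, the order of
    \<open>s3\<close>; subtracting it leaves a divisor of 16 that is at least 32.\<close>
  from dvd_diff[OF dvd_refl this] have "32 * 2 ^ m dvd (16 :: int)" by simp
  then have "32 * 2 ^ m \<le> (16 :: int)" by (rule zdvd_imp_le) simp
  moreover have "(1 :: int) \<le> 2 ^ m" by simp
  ultimately show False by linarith
qed

end
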